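(* Let $H$ be a Hopf algebra over a field $k$ with antipode $S$. Then $H$ is symmetric as a coalgebra if and only if $H$ is unimodular and there exists an invertible element $u$ of the algebra $H^*$ such that $S^2(h)=u^{-1}\cdot h\cdot u=\sum u(h_1)u^{-1}(h_3)h_2$ for all $h\in H$.
   Context: For a coalgebra $C$ over $k$ with $\Delta(x)=\sum x_1\otimes x_2$, the dual $C^*$ is an algebra with the convolution product $(c^*d^* )(x)=\sum c^*(x_1)d^*(x_2)$. $C$ is a $(C^*,C^* )$-bimodule with $c^*\cdot x=\sum c^*(x_2)x_1$ and $x\cdot c^*=\sum c^*(x_1)x_2$; $C^*$ is a bimodule over itself by multiplication. $C$ is symmetric if there exists an injective morphism $C\to C^*$ of $(C^*,C^* )$-bimodules. These apply to the underlying coalgebra of $H$; $H$ is not assumed finite dimensional. A left (respectively right) integral on $H$ is an element $t\in H^*$ such that $h^*t=h^*(1)t$ (respectively $th^*=h^*(1)t$) for all $h^*\in H^*$. A Hopf algebra is co-Frobenius as a coalgebra (there exist injective morphisms $H\to H^*$ of left $H^*$-modules and of right $H^*$-modules) if and only if it has non-zero left (or right) integrals; in this case the spaces of left integrals and of right integrals are both one-dimensional. $H$ is called unimodular if it has non-zero integrals and the spaces of left and right integrals on $H$ are equal. *)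

theory Defs
  imports Complex_Main "HOL-Library.Poly_Mapping"
begin

section \<open>Tensors\<close>

text \<open>
  An element \<open>\<Sum> x\<^sub>i \<otimes> y\<^sub>i\<close> of \<open>C \<otimes> C\<close> is written as the list of pairs \<open>(x\<^sub>i, y\<^sub>i)\<close>, and similarly
  a list of triples stands for an element of \<open>C \<otimes> C \<otimes> C\<close>. The tensor product is the free abelian
  group on tuples modulo additivity in each slot and balancedness over the field, so two lists
  denote the same tensor iff their formal sums differ by an element of the subgroup generated by
  these relations.
\<close>

definition formal_sum :: "'a list \<Rightarrow> ('a \<Rightarrow>\<^sub>0 int)" where
  "formal_sum xs = (\<Sum>p\<leftarrow>xs. frag_of p)"

inductive_set tensor2_null :: "('k::field \<Rightarrow> 'c::ab_group_add \<Rightarrow> 'c) \<Rightarrow> (('c \<times> 'c) \<Rightarrow>\<^sub>0 int) set"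
  for scale :: "'k \<Rightarrow> 'c \<Rightarrow> 'c" where
  zero: "0 \<in> tensor2_null scale"
| diff: "u \<in> tensor2_null scale \<Longrightarrow> v \<in> tensor2_null scale \<Longrightarrow> u - v \<in> tensor2_null scale"
| add1: "frag_of (x + x', y) - frag_of (x, y) - frag_of (x', y) \<in> tensor2_null scale"
| add2: "frag_of (x, y + y') - frag_of (x, y) - frag_of (x, y') \<in> tensor2_null scale"
| balanced: "frag_of (scale c x, y) - frag_of (x, scale c y) \<in> tensor2_null scale"

inductive_set tensor3_null :: "('k::field \<Rightarrow> 'c::ab_group_add \<Rightarrow> 'c) \<Rightarrow> (('c \<times> 'c \<times> 'c) \<Rightarrow>\<^sub>0 int) set"
  for scale :: "'k \<Rightarrow> 'c \<Rightarrow> 'c" where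
  zero: "0 \<in> tensor3_null scale"
| diff: "u \<in> tensor3_null scale \<Longrightarrow> v \<in> tensor3_null scale \<Longrightarrow> u - v \<in> tensor3_null scale"
| add1: "frag_of (x + x', y, z) - frag_of (x, y, z) - frag_of (x', y, z) \<in> tensor3_null scale"
| add2: "frag_of (x, y + y', z) - frag_of (x, y, z) - frag_of (x, y', z) \<in> tensor3_null scale"
| add3: "frag_of (x, y, z + z') - frag_of (x, y, z) - frag_of (x, y, z') \<in> tensor3_null scale"
| balanced12: "frag_of (scale c x, y, z) - frag_of (x, scale c y, z) \<in> tensor3_null scale"
| balanced23: "frag_of (x, scale c y, z) - frag_of (x, y, scale c z) \<in> tensor3_null scale"

definition tensor2_eq ::
    "('k::field \<Rightarrow> 'c::ab_group_add \<Rightarrow> 'c) \<Rightarrow> ('c \<times> 'c) list \<Rightarrow> ('c \<times> 'c) list \<Rightarrow> bool" where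
  "tensor2_eq scale xs ys \<longleftrightarrow> formal_sum xs - formal_sum ys \<in> tensor2_null scale"

definition tensor3_eq ::
    "('k::field \<Rightarrow> 'c::ab_group_add \<Rightarrow> 'c) \<Rightarrow> ('c \<times> 'c \<times> 'c) list \<Rightarrow> ('c \<times> 'c \<times> 'c) list \<Rightarrow> bool" where
  "tensor3_eq scale xs ys \<longleftrightarrow> formal_sum xs - formal_sum ys \<in> tensor3_null scale"


section \<open>Coalgebras and Hopf algebras\<close>

text \<open>
  \<open>comult x\<close> is a list of pairs \<open>(x\<^sub>1, x\<^sub>2)\<close> with \<open>\<Delta>(x) = \<Sum> x\<^sub>1 \<otimes> x\<^sub>2\<close>. Only its class in
  \<open>C \<otimes> C\<close> matters: the axioms hold up to equality of tensors, and every later use of \<open>comult\<close>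
  sums a multilinear expression over the list. Thus \<open>\<Sum>(a, b)\<leftarrow>comult x. f a b\<close> is the
  Sweedler sum \<open>\<Sum> f(x\<^sub>1, x\<^sub>2)\<close>.
\<close>

locale coalgebra = vector_space scale
  for scale :: "'k::field \<Rightarrow> 'c::ab_group_add \<Rightarrow> 'c" +
  fixes comult :: "'c \<Rightarrow> ('c \<times> 'c) list"
    and counit :: "'c \<Rightarrow> 'k"
  assumes comult_add: "tensor2_eq scale (comult (x + y)) (comult x @ comult y)"
    and comult_scale: "tensor2_eq scale (comult (scale c x)) [(scale c a, b). (a, b) \<leftarrow> comult x]"
    and counit_linear: "Vector_Spaces.linear scale (*) counit"
    and coassoc: "tensor3_eq scale
          [(a, b, d). (p, d) \<leftarrow> comult x, (a, b) \<leftarrow> comult p]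
          [(a, b, d). (a, q) \<leftarrow> comult x, (b, d) \<leftarrow> comult q]"
    and counit_left: "(\<Sum>(a, b)\<leftarrow>comult x. scale (counit a) b) = x"
    and counit_right: "(\<Sum>(a, b)\<leftarrow>comult x. scale (counit b) a) = x"

locale hopf_algebra = coalgebra scale comult counit
  for scale :: "'k::field \<Rightarrow> 'h::ring_1 \<Rightarrow> 'h"
    and comult :: "'h \<Rightarrow> ('h \<times> 'h) list"
    and counit :: "'h \<Rightarrow> 'k" +
  fixes antipode :: "'h \<Rightarrow> 'h"
  assumes scale_mult_left: "scale c x * y = scale c (x * y)"
    and scale_mult_right: "x * scale c y = scale c (x * y)"
    and comult_one: "tensor2_eq scale (comult 1) [(1, 1)]"
    and comult_mult: "tensor2_eq scale (comult (x * y))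
          [(a * c, b * d). (a, b) \<leftarrow> comult x, (c, d) \<leftarrow> comult y]"
    and counit_one: "counit 1 = 1"
    and counit_mult: "counit (x * y) = counit x * counit y"
    and antipode_linear: "Vector_Spaces.linear scale scale antipode"
    and antipode_left: "(\<Sum>(a, b)\<leftarrow>comult x. antipode a * b) = scale (counit x) 1"
    and antipode_right: "(\<Sum>(a, b)\<leftarrow>comult x. a * antipode b) = scale (counit x) 1"


section \<open>The dual algebra and its bimodules\<close>

definition dual_space :: "('k::field \<Rightarrow> 'c::ab_group_add \<Rightarrow> 'c) \<Rightarrow> ('c \<Rightarrow> 'k) set" where
  "dual_space scale = {f. Vector_Spaces.linear scale (*) f}"

definition convolution ::
    "('c \<Rightarrow> ('c \<times> 'c) list) \<Rightarrow> ('c \<Rightarrow> 'k::field) \<Rightarrow> ('c \<Rightarrow> 'k) \<Rightarrow> ('c \<Rightarrow> 'k)" where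
  "convolution comult f g = (\<lambda>x. \<Sum>(a, b)\<leftarrow>comult x. f a * g b)"

definition left_act :: "('k::field \<Rightarrow> 'c::ab_group_add \<Rightarrow> 'c) \<Rightarrow> ('c \<Rightarrow> ('c \<times> 'c) list) \<Rightarrow>
    ('c \<Rightarrow> 'k) \<Rightarrow> 'c \<Rightarrow> 'c" where
  "left_act scale comult f x = (\<Sum>(a, b)\<leftarrow>comult x. scale (f b) a)"

definition right_act :: "('k::field \<Rightarrow> 'c::ab_group_add \<Rightarrow> 'c) \<Rightarrow> ('c \<Rightarrow> ('c \<times> 'c) list) \<Rightarrow>
    'c \<Rightarrow> ('c \<Rightarrow> 'k) \<Rightarrow> 'c" where
  "right_act scale comult x f = (\<Sum>(a, b)\<leftarrow>comult x. scale (f a) b)"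

definition dual_bimodule_hom :: "('k::field \<Rightarrow> 'c::ab_group_add \<Rightarrow> 'c) \<Rightarrow>
    ('c \<Rightarrow> ('c \<times> 'c) list) \<Rightarrow> ('c \<Rightarrow> 'c \<Rightarrow> 'k) \<Rightarrow> bool" where
  "dual_bimodule_hom scale comult \<alpha> \<longleftrightarrow>
     (\<forall>x. \<alpha> x \<in> dual_space scale) \<and>
     (\<forall>x y. \<alpha> (x + y) = (\<lambda>z. \<alpha> x z + \<alpha> y z)) \<and>
     (\<forall>c x. \<alpha> (scale c x) = (\<lambda>z. c * \<alpha> x z)) \<and>
     (\<forall>f\<in>dual_space scale. \<forall>x.
        \<alpha> (left_act scale comult f x) = convolution comult f (\<alpha> x) \<and>
        \<alpha> (right_act scale comult x f) = convolution comult (\<alpha> x) f)"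

definition symmetric_coalgebra :: "('k::field \<Rightarrow> 'c::ab_group_add \<Rightarrow> 'c) \<Rightarrow>
    ('c \<Rightarrow> ('c \<times> 'c) list) \<Rightarrow> bool" where
  "symmetric_coalgebra scale comult \<longleftrightarrow> (\<exists>\<alpha>. dual_bimodule_hom scale comult \<alpha> \<and> inj \<alpha>)"

text \<open>The unit of the algebra \<open>C\<^sup>*\<close> is the counit of \<open>C\<close>.\<close>

definition dual_inverses :: "('k::field \<Rightarrow> 'c::ab_group_add \<Rightarrow> 'c) \<Rightarrow>
    ('c \<Rightarrow> ('c \<times> 'c) list) \<Rightarrow> ('c \<Rightarrow> 'k) \<Rightarrow> ('c \<Rightarrow> 'k) \<Rightarrow> ('c \<Rightarrow> 'k) \<Rightarrow> bool" where
  "dual_inverses scale comult counit u v \<longleftrightarrow>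
     u \<in> dual_space scale \<and> v \<in> dual_space scale \<and>
     convolution comult u v = counit \<and> convolution comult v u = counit"


section \<open>Integrals\<close>

definition left_integrals :: "('k::field \<Rightarrow> 'h::ring_1 \<Rightarrow> 'h) \<Rightarrow> ('h \<Rightarrow> ('h \<times> 'h) list) \<Rightarrow>
    ('h \<Rightarrow> 'k) set" where
  "left_integrals scale comult =
     {t \<in> dual_space scale. \<forall>f\<in>dual_space scale. convolution comult f t = (\<lambda>x. f 1 * t x)}"

definition right_integrals :: "('k::field \<Rightarrow> 'h::ring_1 \<Rightarrow> 'h) \<Rightarrow> ('h \<Rightarrow> ('h \<times> 'h) list) \<Rightarrow>
    ('h \<Rightarrow> 'k) set" where
  "right_integrals scale comult =
     {t \<in> dual_space scale. \<forall>f\<in>dual_space scale. convolution comult t f = (\<lambda>x. f 1 * t x)}"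

definition unimodular :: "('k::field \<Rightarrow> 'h::ring_1 \<Rightarrow> 'h) \<Rightarrow> ('h \<Rightarrow> ('h \<times> 'h) list) \<Rightarrow> bool" where
  "unimodular scale comult \<longleftrightarrow>
     (\<exists>t \<in> left_integrals scale comult \<union> right_integrals scale comult. t \<noteq> (\<lambda>x. 0)) \<and>
     left_integrals scale comult = right_integrals scale comult"

end

theory Submission
  imports Defs
begin

text \<open>
  A bimodule morphism \<open>\<alpha> : H \<rightarrow> H\<^sup>*\<close> is the same thing as a bilinear form \<open>B(x, y) = \<alpha>(x)(y)\<close> with
  \<open>\<Sum> B(x\<^sub>1, y) x\<^sub>2 = \<Sum> B(x, y\<^sub>2) y\<^sub>1\<close> and \<open>\<Sum> B(x\<^sub>2, y) x\<^sub>1 = \<Sum> B(x, y\<^sub>1) y\<^sub>2\<close>; such a form is called balanced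
  here, and symmetry of \<open>H\<close> means that there is a balanced form \<open>B\<close> with \<open>x \<mapsto> B(x, -)\<close> injective. The
  theorem follows from an explicit description of the balanced forms on a Hopf algebra with a
  nonzero two-sided integral \<open>t\<close>. For \<open>w \<in> H\<^sup>*\<close> put \<open>B\<^sub>w(x, y) = t(x S(y \<cdot> w)) = \<Sum> w(y\<^sub>1) t(x S(y\<^sub>2))\<close>.

  The second balance condition holds for every \<open>B\<^sub>w\<close>, by the integral property of \<open>t\<close>. Conversely,
  every balanced form is some \<open>B\<^sub>w\<close> (\<open>balanced_form_twisted\<close>). Indeed, the functionals \<open>B(-, y)\<close> lie in
  the right Hopf module of functionals \<open>f\<close> such that \<open>\<Sum> f(x\<^sub>2) x\<^sub>1 = \<Sum> f\<^sub>0(x) f\<^sub>1\<close> for a tensor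
  \<open>\<Sum> f\<^sub>0 \<otimes> f\<^sub>1\<close>. Its coinvariants are the left integrals, so the projection of a Hopf module
  onto its coinvariants sends \<open>B(-, y)\<close> to a multiple \<open>w(y) t\<close>, and reconstructing \<open>B(-, y)\<close> from
  these projections gives \<open>B = B\<^sub>w\<close>. The first balance condition for \<open>B\<^sub>w\<close> says exactly that
  \<open>S\<^sup>2(x \<cdot> w) = w \<cdot> x\<close> (\<open>balanced_twisted_form_iff\<close>), which for invertible \<open>w = u\<^sup>-\<^sup>1\<close> is the formula
  \<open>S\<^sup>2(h) = u\<^sup>-\<^sup>1 \<cdot> h \<cdot> u\<close>.

  If \<open>H\<close> is unimodular and \<open>S\<^sup>2\<close> is inner, then \<open>B\<^sub>w\<close> is therefore balanced. It is injective because
  \<open>S\<close> is bijective and \<open>t(x h) = 0\<close> for all \<open>h\<close> forces \<open>x = 0\<close> (\<open>left_integral_nondegenerate'\<close>).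

  If \<open>B\<close> is balanced and injective, then \<open>B\<close> is automatically symmetric (\<open>balanced_form_symmetric\<close>).
  The functional \<open>t = B(1, -)\<close> is a nonzero two-sided integral. Its existence makes \<open>S\<close> injective, which
  gives uniqueness of integrals (\<open>two_sided_integral_unique\<close>) and hence unimodularity. Writing
  \<open>B = B\<^sub>w\<close>, symmetry makes \<open>y \<mapsto> y \<cdot> w\<close> injective, and since \<open>H\<close> is locally finite as an
  \<open>H\<^sup>*\<close>-module this makes \<open>w\<close> invertible (\<open>right_act_injective_imp_invertible\<close>).

  Identities between elements of \<open>H\<close> or of its tensor powers are tested against functionals, so that
  all Sweedler sums take values in the field.
\<close>


section \<open>Multilinear expressions on tensors\<close>

text \<open>The additive extension of \<open>F\<close> to the free abelian group.\<close>

definition frag_eval :: "('a \<Rightarrow> 'k::field) \<Rightarrow> ('a \<Rightarrow>\<^sub>0 int) \<Rightarrow> 'k" where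
  "frag_eval F u = (\<Sum>p\<in>Poly_Mapping.keys u. of_int (Poly_Mapping.lookup u p) * F p)"

lemma frag_eval_superset:
  assumes "finite A" "Poly_Mapping.keys u \<subseteq> A"
  shows "frag_eval F u = (\<Sum>p\<in>A. of_int (Poly_Mapping.lookup u p) * F p)"
  unfolding frag_eval_def
  using assms by (intro sum.mono_neutral_left) (auto simp: in_keys_iff)

lemma frag_eval_diff: "frag_eval F (u - v) = frag_eval F u - frag_eval F v"
proof -
  let ?A = "Poly_Mapping.keys u \<union> Poly_Mapping.keys v"
  have "Poly_Mapping.keys (u - v) \<subseteq> ?A"
    by (rule keys_diff)
  then show ?thesis
    by (simp add: frag_eval_superset[of ?A] lookup_minus algebra_simps sum_subtractf)
qed

lemma frag_eval_zero [simp]: "frag_eval F 0 = 0"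
  by (simp add: frag_eval_def)

lemma frag_eval_add: "frag_eval F (u + v) = frag_eval F u + frag_eval F v"
  using frag_eval_diff[of F "u + v" v] by simp

lemma frag_eval_of [simp]: "frag_eval F (frag_of p) = F p"
  by (simp add: frag_eval_def)

lemma frag_eval_formal_sum: "frag_eval F (formal_sum xs) = (\<Sum>p\<leftarrow>xs. F p)"
  unfolding formal_sum_def by (induction xs) (simp_all add: frag_eval_add)

lemma tensor2_null_eval:
  assumes "u \<in> tensor2_null scale"
    and "\<And>x x' y. F (x + x') y = F x y + F x' y"
    and "\<And>x y y'. F x (y + y') = F x y + F x y'"
    and "\<And>c x y. F (scale c x) y = F x (scale c y)"
  shows "frag_eval (\<lambda>(x, y). F x y) u = 0"
  using assms(1) by induction (simp_all add: frag_eval_diff assms(2-))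

lemma tensor3_null_eval:
  assumes "u \<in> tensor3_null scale"
    and "\<And>x x' y z. F (x + x') y z = F x y z + F x' y z"
    and "\<And>x y y' z. F x (y + y') z = F x y z + F x y' z"
    and "\<And>x y z z'. F x y (z + z') = F x y z + F x y z'"
    and "\<And>c x y z. F (scale c x) y z = F x (scale c y) z"
    and "\<And>c x y z. F x (scale c y) z = F x y (scale c z)"
  shows "frag_eval (\<lambda>(x, y, z). F x y z) u = 0"
  using assms(1) by induction (simp_all add: frag_eval_diff assms(2-))

lemma sum_list_concat_map:
  "(\<Sum>p\<leftarrow>concat (map g xs). F p) = (\<Sum>x\<leftarrow>xs. \<Sum>p\<leftarrow>g x. F p)"
  by (induction xs) simp_all

lemma sum_list_swap:
  "(\<Sum>x\<leftarrow>xs. \<Sum>y\<leftarrow>ys. F x y) = (\<Sum>y\<leftarrow>ys. \<Sum>x\<leftarrow>xs. (F x y :: 'k::comm_monoid_add))"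
  by (induction xs) (simp_all add: sum_list_addf)

lemma sum_list_hom:
  assumes "h 0 = (0 :: 'b::monoid_add)" "\<And>x y. h (x + y) = h x + h y"
  shows "h (\<Sum>x\<leftarrow>xs. F x) = (\<Sum>x\<leftarrow>xs. h (F x))"
  by (induction xs) (simp_all add: assms)


section \<open>Linear functionals\<close>

text \<open>
  Rules for showing that a Sweedler summand is linear in one of its factors. Composition with a
  functional \<open>f\<close> is added locally as \<open>functional_comp[OF f]\<close>: only with \<open>f\<close> fixed is the conclusion a
  higher-order pattern, so that resolution and rewriting with the rules terminate.
\<close>

named_theorems linearity

context coalgebra
begin

abbreviation functional :: "('c \<Rightarrow> 'k) \<Rightarrow> bool" where
  "functional \<equiv> Vector_Spaces.linear scale (*)"

abbreviation endomorphism :: "('c \<Rightarrow> 'c) \<Rightarrow> bool" where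
  "endomorphism \<equiv> Vector_Spaces.linear scale scale"

lemma functional_iff:
  "functional f \<longleftrightarrow> (\<forall>x y. f (x + y) = f x + f y) \<and> (\<forall>c x. f (scale c x) = c * f x)"
  by (auto simp: Vector_Spaces.linear_iff vector_space_axioms intro!: vector_space.intro simp: algebra_simps)

lemma endomorphism_iff:
  "endomorphism f \<longleftrightarrow> (\<forall>x y. f (x + y) = f x + f y) \<and> (\<forall>c x. f (scale c x) = scale c (f x))"
  by (auto simp: Vector_Spaces.linear_iff vector_space_axioms)

lemma functional_add: "functional f \<Longrightarrow> f (x + y) = f x + f y"
  and functional_scale: "functional f \<Longrightarrow> f (scale c x) = c * f x"
  by (simp_all add: functional_iff)

lemma functional_zero: "functional f \<Longrightarrow> f 0 = 0"
  using functional_scale[of f 0 0] by simp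

lemma functional_diff: "functional f \<Longrightarrow> f (x - y) = f x - f y"
  using functional_add[of f "x - y" y] by simp

lemma functional_sum_list: "functional f \<Longrightarrow> f (\<Sum>x\<leftarrow>xs. g x) = (\<Sum>x\<leftarrow>xs. f (g x))"
  by (rule sum_list_hom) (simp_all add: functional_zero functional_add)

lemma functional_comp: "functional f \<Longrightarrow> endomorphism g \<Longrightarrow> functional (\<lambda>x. f (g x))"
  by (simp add: functional_iff endomorphism_iff)

lemma endomorphism_comp: "endomorphism f \<Longrightarrow> endomorphism g \<Longrightarrow> endomorphism (\<lambda>x. f (g x))"
  by (simp add: endomorphism_iff)

lemma functional_mult_right [linearity]: "functional f \<Longrightarrow> functional (\<lambda>x. f x * c)"
  and functional_mult_left [linearity]: "functional f \<Longrightarrow> functional (\<lambda>x. c * f x)"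
  and functional_diff_fun [linearity]: "functional f \<Longrightarrow> functional g \<Longrightarrow> functional (\<lambda>x. f x - g x)"
  and endomorphism_id [linearity]: "endomorphism (\<lambda>x. x)"
  by (simp_all add: functional_iff endomorphism_iff algebra_simps)

lemma functional_coordinate:
  assumes "independent B" "span B = UNIV"
  shows "functional (\<lambda>x. representation B x b)"
  using linear_representation[OF assms] .

lemma basis_exists:
  obtains B where "independent B" "span B = UNIV"
proof -
  have "independent (extend_basis {})" "span (extend_basis {}) = UNIV"
    by (simp_all add: independent_extend_basis span_extend_basis independent_empty)
  then show ?thesis
    by (rule that)
qed

lemma functional_ext:
  assumes "\<And>f. functional f \<Longrightarrow> f x = f y"
  shows "x = y"
proof -
  obtain B where B: "independent B" "span B = UNIV"
    by (rule basis_exists)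
  have "representation B x = representation B y"
    using assms[OF functional_coordinate[OF B]] by blast
  moreover have "(\<Sum>b | representation B v b \<noteq> 0. scale (representation B v b) b) = v" for v
    using B by (intro sum_nonzero_representation_eq) auto
  ultimately show ?thesis
    by metis
qed

text \<open>
  If the tensor \<open>\<Sum> a \<otimes> b\<close> is killed by the functionals \<open>F(-, b') \<otimes> f\<close>, its second components may
  be taken from a basis; then every \<open>F(-, b')\<close> kills every first component, in particular with
  \<open>b'\<close> the matching second component.
\<close>

lemma diagonal_zero:
  assumes lin: "\<And>a. functional (F a)"
    and zero: "\<And>b' f. functional f \<Longrightarrow> (\<Sum>(a, b)\<leftarrow>ps. F a b' * f b) = 0"
  shows "(\<Sum>(a, b)\<leftarrow>ps. F a b) = 0"
proof -
  obtain B where B: "independent B" "span B = UNIV"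
    by (rule basis_exists)
  define C where "C = (\<Union>b\<in>snd ` set ps. {c. representation B b c \<noteq> 0})"
  have fin: "finite C"
    by (auto simp: C_def finite_representation)
  have expand: "F a b = (\<Sum>c\<in>C. F a c * representation B b c)" if "(a, b) \<in> set ps" for a b
  proof -
    have "{c. representation B b c \<noteq> 0} \<subseteq> C"
      using that by (force simp: C_def)
    then have "(\<Sum>c\<in>C. scale (representation B b c) c)
        = (\<Sum>c | representation B b c \<noteq> 0. scale (representation B b c) c)"
      by (intro sum.mono_neutral_right[OF fin]) auto
    also have "\<dots> = b"
      using B by (intro sum_nonzero_representation_eq) auto
    finally have "F a b = F a (\<Sum>c\<in>C. scale (representation B b c) c)"
      by simp
    also have "\<dots> = (\<Sum>c\<in>C. F a (scale (representation B b c) c))"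
      by (induction C rule: infinite_finite_induct)
        (simp_all add: functional_zero[OF lin] functional_add[OF lin])
    finally show ?thesis
      by (simp add: functional_scale[OF lin] mult.commute)
  qed
  have "(\<Sum>(a, b)\<leftarrow>ps. F a b) = (\<Sum>(a, b)\<leftarrow>ps. \<Sum>c\<in>C. F a c * representation B b c)"
    using expand by (intro arg_cong[where f = sum_list] map_cong) auto
  also have "\<dots> = (\<Sum>c\<in>C. \<Sum>(a, b)\<leftarrow>ps. F a c * representation B b c)"
    by (induction ps) (auto simp: sum.distrib)
  also have "\<dots> = 0"
    using zero[OF functional_coordinate[OF B]] by simp
  finally show ?thesis .
qed


section \<open>Sweedler sums\<close>

definition sweedler :: "'c \<Rightarrow> ('c \<Rightarrow> 'c \<Rightarrow> 'k) \<Rightarrow> 'k" where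
  "sweedler x F = (\<Sum>(a, b)\<leftarrow>comult x. F a b)"

lemma tensor2_eq_sum:
  assumes "tensor2_eq scale ps qs" "\<And>b. functional (\<lambda>a. F a b)" "\<And>a. functional (F a)"
  shows "(\<Sum>(a, b)\<leftarrow>ps. F a b) = (\<Sum>(a, b)\<leftarrow>qs. F a b)"
proof -
  have "frag_eval (\<lambda>(x, y). F x y) (formal_sum ps - formal_sum qs) = 0"
    using assms(1) functional_add[OF assms(2)] functional_scale[OF assms(2)]
      functional_add[OF assms(3)] functional_scale[OF assms(3)]
    by (intro tensor2_null_eval[of _ scale]) (simp_all add: tensor2_eq_def)
  then show ?thesis
    by (simp add: frag_eval_diff frag_eval_formal_sum)
qed

lemma tensor3_eq_sum:
  assumes "tensor3_eq scale ps qs" "\<And>b c. functional (\<lambda>a. F a b c)" "\<And>a c. functional (\<lambda>b. F a b c)"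
    "\<And>a b. functional (F a b)"
  shows "(\<Sum>(a, b, c)\<leftarrow>ps. F a b c) = (\<Sum>(a, b, c)\<leftarrow>qs. F a b c)"
proof -
  have "frag_eval (\<lambda>(x, y, z). F x y z) (formal_sum ps - formal_sum qs) = 0"
    using assms(1) functional_add[OF assms(2)] functional_scale[OF assms(2)]
      functional_add[OF assms(3)] functional_scale[OF assms(3)]
      functional_add[OF assms(4)] functional_scale[OF assms(4)]
    by (intro tensor3_null_eval[of _ scale]) (simp_all add: tensor3_eq_def)
  then show ?thesis
    by (simp add: frag_eval_diff frag_eval_formal_sum)
qed

lemma sweedler_add:
  assumes "\<And>b. functional (\<lambda>a. F a b)" "\<And>a. functional (F a)"
  shows "sweedler (x + y) F = sweedler x F + sweedler y F"
  unfolding sweedler_def by (subst tensor2_eq_sum[OF comult_add assms]) simp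

lemma sweedler_scale:
  assumes "\<And>b. functional (\<lambda>a. F a b)" "\<And>a. functional (F a)"
  shows "sweedler (scale c x) F = c * sweedler x F"
  unfolding sweedler_def
  by (subst tensor2_eq_sum[OF comult_scale assms])
    (simp add: o_def case_prod_unfold functional_scale[OF assms(1)] sum_list_const_mult)

lemma functional_sweedler_arg:
  assumes "\<And>b. functional (\<lambda>a. F a b)" "\<And>a. functional (F a)"
  shows "functional (\<lambda>x. sweedler x F)"
  using assms by (simp add: functional_iff[of "\<lambda>x. sweedler x F"] sweedler_add sweedler_scale)

lemma functional_sweedler [linearity]:
  assumes "endomorphism g" "\<And>b. functional (\<lambda>a. F a b)" "\<And>a. functional (F a)"
  shows "functional (\<lambda>x. sweedler (g x) F)"
  by (rule functional_comp[OF functional_sweedler_arg]) fact+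

lemma functional_sweedler_body [linearity]:
  assumes "\<And>a b. functional (\<lambda>x. F x a b)"
  shows "functional (\<lambda>x. sweedler y (F x))"
  using functional_add[OF assms] functional_scale[OF assms]
  by (simp add: functional_iff sweedler_def case_prod_unfold sum_list_addf sum_list_const_mult)

text \<open>
  Used as a rewrite rule this nests all Sweedler sums to the right. Two sums that differ only in
  their bracketing thus have the same normal form, which is how every rebracketing below is done.
\<close>

lemma sweedler_coassoc:
  assumes "\<And>b c. functional (\<lambda>a. F a b c)" "\<And>a c. functional (\<lambda>b. F a b c)"
    "\<And>a b. functional (F a b)"
  shows "sweedler x (\<lambda>p c. sweedler p (\<lambda>a b. F a b c)) = sweedler x (\<lambda>a q. sweedler q (F a))"
  using tensor3_eq_sum[OF coassoc assms, of x]
  by (simp add: sweedler_def case_prod_unfold sum_list_concat_map o_def)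

lemma sweedler_swap:
  "sweedler x (\<lambda>a b. sweedler y (\<lambda>c d. F a b c d)) = sweedler y (\<lambda>c d. sweedler x (\<lambda>a b. F a b c d))"
  unfolding sweedler_def case_prod_unfold by (rule sum_list_swap)

lemma sweedler_mult_left: "sweedler x (\<lambda>a b. c * F a b) = c * sweedler x F"
  and sweedler_mult_right: "sweedler x (\<lambda>a b. F a b * c) = sweedler x F * c"
  and sweedler_diff: "sweedler x (\<lambda>a b. F a b - G a b) = sweedler x F - sweedler x G"
  by (simp_all add: sweedler_def case_prod_unfold sum_list_const_mult sum_list_mult_const sum_list_subtractf)

lemma sweedler_zero [simp]: "sweedler x (\<lambda>a b. 0) = 0"
  by (simp add: sweedler_def case_prod_unfold)

lemma functional_counit: "functional counit"
  by (rule counit_linear)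

lemma sweedler_counit_left: "functional f \<Longrightarrow> sweedler x (\<lambda>a b. counit a * f b) = f x"
  by (subst (2) counit_left[symmetric])
    (simp add: sweedler_def case_prod_unfold functional_sum_list functional_scale)

lemma sweedler_counit_right: "functional f \<Longrightarrow> sweedler x (\<lambda>a b. counit b * f a) = f x"
  by (subst (2) counit_right[symmetric])
    (simp add: sweedler_def case_prod_unfold functional_sum_list functional_scale)

lemma sweedler_diagonal_zero:
  assumes "\<And>a. functional (F a)" "\<And>b' f. functional f \<Longrightarrow> sweedler x (\<lambda>a b. F a b' * f b) = 0"
  shows "sweedler x F = 0"
  using diagonal_zero[of F "comult x"] assms unfolding sweedler_def by blast

lemma sweedler_diagonal_zero':
  assumes "\<And>b. functional (\<lambda>a. F a b)" "\<And>a' f. functional f \<Longrightarrow> sweedler x (\<lambda>a b. f a * F a' b) = 0"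
  shows "sweedler x F = 0"
  using diagonal_zero[of "\<lambda>b a. F a b" "map prod.swap (comult x)"] assms
  by (simp add: sweedler_def o_def case_prod_unfold mult.commute)

lemma functional_convolution:
  "functional f \<Longrightarrow> functional g \<Longrightarrow> functional (convolution comult f g)"
  using functional_sweedler_arg[of "\<lambda>a b. f a * g b"]
  by (simp add: convolution_def sweedler_def functional_mult_left functional_mult_right)

lemma convolution_sweedler: "convolution comult f g x = sweedler x (\<lambda>a b. f a * g b)"
  by (simp add: convolution_def sweedler_def)

lemma functional_left_act:
  "functional g \<Longrightarrow> g (left_act scale comult f x) = sweedler x (\<lambda>a b. f b * g a)"
  by (simp add: left_act_def sweedler_def case_prod_unfold functional_sum_list functional_scale)

lemma functional_right_act:
  "functional g \<Longrightarrow> g (right_act scale comult x f) = sweedler x (\<lambda>a b. f a * g b)"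
  by (simp add: right_act_def sweedler_def case_prod_unfold functional_sum_list functional_scale)


section \<open>The actions of the dual algebra\<close>

abbreviation lact :: "('c \<Rightarrow> 'k) \<Rightarrow> 'c \<Rightarrow> 'c" (infixr \<open>\<rightharpoonup>\<close> 75) where
  "f \<rightharpoonup> x \<equiv> left_act scale comult f x"

abbreviation ract :: "'c \<Rightarrow> ('c \<Rightarrow> 'k) \<Rightarrow> 'c" (infixl \<open>\<leftharpoonup>\<close> 75) where
  "x \<leftharpoonup> f \<equiv> right_act scale comult x f"

abbreviation conv :: "('c \<Rightarrow> 'k) \<Rightarrow> ('c \<Rightarrow> 'k) \<Rightarrow> 'c \<Rightarrow> 'k" (infixl \<open>\<star>\<close> 70) where
  "f \<star> g \<equiv> convolution comult f g"

lemma sweedler_left_act: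
  assumes "\<And>b. functional (\<lambda>a. F a b)" "\<And>a. functional (F a)"
  shows "sweedler (f \<rightharpoonup> x) F = sweedler x (\<lambda>a b. f b * sweedler a F)"
  by (rule functional_left_act[OF functional_sweedler_arg[OF assms]])

lemma sweedler_right_act:
  assumes "\<And>b. functional (\<lambda>a. F a b)" "\<And>a. functional (F a)"
  shows "sweedler (x \<leftharpoonup> f) F = sweedler x (\<lambda>a b. f a * sweedler b F)"
  by (rule functional_right_act[OF functional_sweedler_arg[OF assms]])

lemma left_act_counit: "counit \<rightharpoonup> x = x"
  and right_act_counit: "x \<leftharpoonup> counit = x"
  using counit_right counit_left by (simp_all add: left_act_def right_act_def)

lemma counit_left_act: "functional f \<Longrightarrow> counit (f \<rightharpoonup> x) = f x"
  and counit_right_act: "functional f \<Longrightarrow> counit (x \<leftharpoonup> f) = f x"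
  by (simp_all add: functional_left_act functional_right_act functional_counit
      sweedler_counit_left sweedler_counit_right mult.commute[of "f _"])

lemma left_act_left_act:
  assumes f: "functional f" and g: "functional g"
  shows "f \<rightharpoonup> g \<rightharpoonup> x = (f \<star> g) \<rightharpoonup> x"
proof (rule functional_ext)
  fix h assume h: "functional h"
  note [linearity] = f g h
  have "h (f \<rightharpoonup> g \<rightharpoonup> x) = sweedler x (\<lambda>p c. sweedler p (\<lambda>a b. g c * (f b * h a)))"
    by (simp add: functional_left_act[OF h] sweedler_left_act sweedler_mult_left linearity)
  also have "\<dots> = sweedler x (\<lambda>a q. sweedler q (\<lambda>b c. f b * g c * h a))"
    by (simp only: sweedler_coassoc linearity) (simp add: mult_ac)
  also have "\<dots> = h ((f \<star> g) \<rightharpoonup> x)"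
    by (simp add: functional_left_act[OF h] convolution_sweedler sweedler_mult_right)
  finally show "h (f \<rightharpoonup> g \<rightharpoonup> x) = h ((f \<star> g) \<rightharpoonup> x)" .
qed

lemma right_act_right_act:
  assumes f: "functional f" and g: "functional g"
  shows "x \<leftharpoonup> f \<leftharpoonup> g = x \<leftharpoonup> (f \<star> g)"
proof (rule functional_ext)
  fix h assume h: "functional h"
  note [linearity] = f g h
  have "h (x \<leftharpoonup> (f \<star> g)) = sweedler x (\<lambda>p c. sweedler p (\<lambda>a b. f a * g b * h c))"
    by (simp add: functional_right_act[OF h] convolution_sweedler sweedler_mult_right)
  also have "\<dots> = sweedler x (\<lambda>a q. sweedler q (\<lambda>b c. f a * (g b * h c)))"
    by (simp only: sweedler_coassoc linearity mult.assoc)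
  also have "\<dots> = h (x \<leftharpoonup> f \<leftharpoonup> g)"
    by (simp add: functional_right_act[OF h] sweedler_right_act sweedler_mult_left linearity)
  finally show "h (x \<leftharpoonup> f \<leftharpoonup> g) = h (x \<leftharpoonup> (f \<star> g))"
    by simp
qed

lemma left_act_right_act_sum:
  assumes f: "functional f" and g: "functional g"
  shows "(f \<rightharpoonup> x) \<leftharpoonup> g = (\<Sum>(a, q)\<leftarrow>comult x. \<Sum>(b, c)\<leftarrow>comult q. scale (g a * f c) b)"
    and "f \<rightharpoonup> (x \<leftharpoonup> g) = (\<Sum>(a, q)\<leftarrow>comult x. \<Sum>(b, c)\<leftarrow>comult q. scale (g a * f c) b)"
proof -
  let ?s = "\<Sum>(a, q)\<leftarrow>comult x. \<Sum>(b, c)\<leftarrow>comult q. scale (g a * f c) b"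
  have s: "h ?s = sweedler x (\<lambda>a q. sweedler q (\<lambda>b c. g a * f c * h b))" if h: "functional h" for h
    by (simp add: functional_sum_list[OF h] functional_scale[OF h] sweedler_def case_prod_unfold)
  show "(f \<rightharpoonup> x) \<leftharpoonup> g = ?s"
  proof (rule functional_ext)
    fix h assume h: "functional h"
    note [linearity] = f g h
    have "h ((f \<rightharpoonup> x) \<leftharpoonup> g) = sweedler x (\<lambda>p c. sweedler p (\<lambda>a b. f c * (g a * h b)))"
      by (simp add: functional_right_act[OF h] sweedler_left_act sweedler_mult_left linearity)
    also have "\<dots> = h ?s"
      by (simp only: s[OF h] sweedler_coassoc linearity) (simp add: mult_ac)
    finally show "h ((f \<rightharpoonup> x) \<leftharpoonup> g) = h ?s" .
  qed
  show "f \<rightharpoonup> (x \<leftharpoonup> g) = ?s"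
  proof (rule functional_ext)
    fix h assume h: "functional h"
    note [linearity] = f g h
    show "h (f \<rightharpoonup> (x \<leftharpoonup> g)) = h ?s"
      by (simp add: functional_left_act[OF h] sweedler_right_act s[OF h] sweedler_mult_left[symmetric] linearity mult.assoc)
  qed
qed

lemma left_act_right_act:
  "functional f \<Longrightarrow> functional g \<Longrightarrow> f \<rightharpoonup> (x \<leftharpoonup> g) = (f \<rightharpoonup> x) \<leftharpoonup> g"
  by (simp add: left_act_right_act_sum)

lemma endomorphism_left_act:
  assumes f: "functional f"
  shows "endomorphism (\<lambda>x. f \<rightharpoonup> x)"
proof -
  have "functional (\<lambda>x. sweedler x (\<lambda>a b. f b * g a))" if "functional g" for g
    using f that by (intro functional_sweedler_arg linearity)
  from functional_add[OF this] functional_scale[OF this] show ?thesis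
    unfolding endomorphism_iff
    by (intro conjI allI; intro functional_ext) (simp_all add: functional_left_act functional_add functional_scale)
qed

lemma endomorphism_right_act:
  assumes f: "functional f"
  shows "endomorphism (\<lambda>x. x \<leftharpoonup> f)"
proof -
  have "functional (\<lambda>x. sweedler x (\<lambda>a b. f a * g b))" if "functional g" for g
    using f that by (intro functional_sweedler_arg linearity)
  from functional_add[OF this] functional_scale[OF this] show ?thesis
    unfolding endomorphism_iff
    by (intro conjI allI; intro functional_ext) (simp_all add: functional_right_act functional_add functional_scale)
qed

text \<open>
  The classical fact for finite-dimensional spaces, relative to an invariant subspace of a space of
  arbitrary dimension: the image of a basis of \<open>W\<close> is independent of the same size, so no vector of
  \<open>W\<close> outside its span can be added to it.
\<close>

lemma injective_imp_surjective_on: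
  assumes \<phi>: "endomorphism \<phi>" "inj \<phi>" and W: "subspace W" "\<phi> ` W \<subseteq> W" and X: "finite X" "W \<subseteq> span X"
  shows "W \<subseteq> \<phi> ` W"
proof
  interpret \<phi>: Vector_Spaces.linear scale scale \<phi>
    by (rule \<phi>(1))
  obtain B where B: "B \<subseteq> W" "independent B" "W \<subseteq> span B"
    using maximal_independent_subset[of W] by blast
  have W_eq: "span B = W"
    using B(3) span_minimal[OF B(1) W(1)] by blast
  have fin: "finite B"
    using independent_span_bound[OF X(1) B(2)] B(1) X(2) by blast
  have indep: "independent (\<phi> ` B)"
    by (rule \<phi>.independent_injective_image[OF B(2)]) (rule inj_on_subset[OF \<phi>(2) subset_UNIV])
  fix y assume y: "y \<in> W"
  show "y \<in> \<phi> ` W"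
  proof (rule ccontr)
    assume "y \<notin> \<phi> ` W"
    then have nin: "y \<notin> span (\<phi> ` B)"
      by (simp add: \<phi>.span_image W_eq)
    then have "independent (insert y (\<phi> ` B))"
      by (rule independent_insertI[OF _ indep])
    moreover have "insert y (\<phi> ` B) \<subseteq> span B"
      using y B(1) W(2) by (auto simp: W_eq)
    ultimately have "card (insert y (\<phi> ` B)) \<le> card B"
      using independent_span_bound[OF fin] by blast
    moreover have "y \<notin> \<phi> ` B"
      using nin span_base by blast
    ultimately show False
      using fin card_image[OF inj_on_subset[OF \<phi>(2) subset_UNIV]] by simp
  qed
qed

text \<open>
  The orbit \<open>y \<leftharpoonup> H\<^sup>*\<close> contains \<open>y\<close>, is mapped into itself because \<open>(y \<leftharpoonup> g) \<leftharpoonup> w = y \<leftharpoonup> (g \<star> w)\<close>,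
  and lies in the span of the finitely many second components of \<open>\<Delta>(y)\<close>. So injectivity can be
  turned into surjectivity one orbit at a time.
\<close>

lemma right_act_surj:
  assumes w: "functional w" and inj: "inj (\<lambda>x. x \<leftharpoonup> w)"
  shows "surj (\<lambda>x. x \<leftharpoonup> w)"
proof -
  have "y \<in> range (\<lambda>x. x \<leftharpoonup> w)" for y
  proof -
    define W where "W = {y \<leftharpoonup> g |g. functional g}"
    have in_span: "y \<leftharpoonup> g \<in> span (snd ` set (comult y))" for g
    proof -
      have "(\<Sum>(a, b)\<leftarrow>ps. scale (g a) b) \<in> span (snd ` set ps)" for ps :: "('c \<times> 'c) list"
      proof (induction ps)
        case (Cons p ps)
        have "(\<Sum>(a, b)\<leftarrow>ps. scale (g a) b) \<in> span (snd ` set (p # ps))"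
          by (rule set_mp[OF span_mono Cons.IH]) auto
        moreover have "scale (g (fst p)) (snd p) \<in> span (snd ` set (p # ps))"
          by (intro span_scale span_base) simp
        ultimately show ?case
          by (simp add: case_prod_unfold span_add)
      qed (simp add: span_zero)
      then show ?thesis
        by (simp add: right_act_def)
    qed
    have sums: "y \<leftharpoonup> g + y \<leftharpoonup> g' = y \<leftharpoonup> (\<lambda>a. g a + g' a)" "scale c (y \<leftharpoonup> g) = y \<leftharpoonup> (\<lambda>a. c * g a)"
      "y \<leftharpoonup> (\<lambda>a. 0) = 0" for g g' c
      by (simp_all add: right_act_def case_prod_unfold sum_list_addf scale_left_distrib
          sum_list_hom[of "scale c"] scale_right_distrib)
    have "functional (\<lambda>a. g a + g' a)" "functional (\<lambda>a. c * g a)" "functional (\<lambda>a. 0)"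
      if "functional g" "functional g'" for g g' c
      using that by (simp_all add: functional_iff algebra_simps)
    then have "subspace W"
      unfolding subspace_def W_def using w by (auto simp: sums) (metis sums(3))
    moreover have "(\<lambda>x. x \<leftharpoonup> w) ` W \<subseteq> W"
      using w by (auto simp: W_def right_act_right_act functional_convolution)
    moreover have "W \<subseteq> span (snd ` set (comult y))"
      using in_span by (auto simp: W_def)
    ultimately have "W \<subseteq> (\<lambda>x. x \<leftharpoonup> w) ` W"
      by (intro injective_imp_surjective_on[OF endomorphism_right_act[OF w] inj]) simp_all
    moreover have "y \<in> W"
      unfolding W_def using right_act_counit[of y, symmetric] functional_counit by blast
    ultimately show ?thesis
      by blast
  qed
  then show ?thesis
    by blast
qed

text \<open>
  The inverse of \<open>x \<mapsto> x \<leftharpoonup> w\<close> commutes with the left action, and an endomorphism \<open>\<psi>\<close> of the left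
  \<open>C\<^sup>*\<close>-module \<open>C\<close> is the right action of \<open>\<epsilon> \<circ> \<psi>\<close>.
\<close>

lemma right_act_injective_imp_invertible:
  assumes w: "functional w" and inj: "inj (\<lambda>x. x \<leftharpoonup> w)"
  obtains v where "dual_inverses scale comult counit v w"
proof -
  define \<psi> where "\<psi> = inv (\<lambda>x. x \<leftharpoonup> w)"
  have \<psi>1: "\<psi> y \<leftharpoonup> w = y" for y
    using surj_f_inv_f[OF right_act_surj[OF assms], of y] by (simp add: \<psi>_def)
  have \<psi>2: "\<psi> (y \<leftharpoonup> w) = y" for y
    using inv_f_f[OF inj, of y] by (simp add: \<psi>_def)
  have eqI: "x = y" if "x \<leftharpoonup> w = y \<leftharpoonup> w" for x y
    using inj that by (simp add: inj_def)
  have "(x + y) \<leftharpoonup> w = x \<leftharpoonup> w + y \<leftharpoonup> w" "scale c x \<leftharpoonup> w = scale c (x \<leftharpoonup> w)" for x y c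
    using endomorphism_right_act[OF w] by (simp_all add: endomorphism_iff)
  then have "\<psi> (x + y) = \<psi> x + \<psi> y" "\<psi> (scale c x) = scale c (\<psi> x)" for x y c
    by (rule_tac eqI; simp add: \<psi>1)+
  then have \<psi>_lin: "endomorphism \<psi>"
    by (simp add: endomorphism_iff)
  define v where "v = (\<lambda>y. counit (\<psi> y))"
  have v: "functional v"
    unfolding v_def by (rule functional_comp[OF functional_counit \<psi>_lin])
  have \<psi>: "\<psi> y = y \<leftharpoonup> v" for y
  proof (rule functional_ext)
    fix f assume f: "functional f"
    have "\<psi> (f \<rightharpoonup> y) = f \<rightharpoonup> \<psi> y"
      by (rule eqI) (simp add: \<psi>1 left_act_right_act[OF f w, symmetric])
    then have "f (\<psi> y) = v (f \<rightharpoonup> y)"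
      by (simp add: v_def counit_left_act[OF f])
    also have "\<dots> = f (y \<leftharpoonup> v)"
      by (simp add: functional_left_act[OF v] functional_right_act[OF f] mult.commute)
    finally show "f (\<psi> y) = f (y \<leftharpoonup> v)" .
  qed
  have "v \<star> w = counit" "w \<star> v = counit"
    using \<psi>1 \<psi>2 counit_right_act[OF functional_convolution[OF v w]] counit_right_act[OF functional_convolution[OF w v]]
    by (simp_all add: fun_eq_iff \<psi> right_act_right_act[OF v w] right_act_right_act[OF w v])
  then show ?thesis
    using v w by (intro that[of v]) (simp add: dual_inverses_def dual_space_def)
qed


section \<open>Balanced bilinear forms\<close>

text \<open>
  Bimodule morphisms \<open>C \<rightarrow> C\<^sup>*\<close> in the guise of bilinear forms, with the two compatibility conditions
  tested against an arbitrary functional.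
\<close>

definition balanced_form :: "('c \<Rightarrow> 'c \<Rightarrow> 'k) \<Rightarrow> bool" where
  "balanced_form B \<longleftrightarrow> (\<forall>x. functional (B x)) \<and> (\<forall>y. functional (\<lambda>x. B x y)) \<and>
    (\<forall>f x y. functional f \<longrightarrow>
      sweedler x (\<lambda>a b. f b * B a y) = sweedler y (\<lambda>c d. f c * B x d) \<and>
      sweedler x (\<lambda>a b. f a * B b y) = sweedler y (\<lambda>c d. B x c * f d))"

lemma dual_bimodule_hom_iff: "dual_bimodule_hom scale comult \<alpha> \<longleftrightarrow> balanced_form \<alpha>"
proof -
  have lin: "(\<forall>x y. \<alpha> (x + y) = (\<lambda>z. \<alpha> x z + \<alpha> y z)) \<and> (\<forall>c x. \<alpha> (scale c x) = (\<lambda>z. c * \<alpha> x z)) \<longleftrightarrow>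
      (\<forall>y. functional (\<lambda>x. \<alpha> x y))"
    by (auto simp: functional_iff fun_eq_iff)
  have act: "\<alpha> (f \<rightharpoonup> x) = f \<star> \<alpha> x \<longleftrightarrow>
      (\<forall>y. sweedler x (\<lambda>a b. f b * \<alpha> a y) = sweedler y (\<lambda>c d. f c * \<alpha> x d))"
    "\<alpha> (x \<leftharpoonup> f) = \<alpha> x \<star> f \<longleftrightarrow>
      (\<forall>y. sweedler x (\<lambda>a b. f a * \<alpha> b y) = sweedler y (\<lambda>c d. \<alpha> x c * f d))"
    if "\<forall>y. functional (\<lambda>x. \<alpha> x y)" for f x
    using functional_left_act[of "\<lambda>x. \<alpha> x y" f x for y] functional_right_act[of "\<lambda>x. \<alpha> x y" x f for y] that
    by (simp_all add: fun_eq_iff convolution_sweedler)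
  have "dual_bimodule_hom scale comult \<alpha> \<longleftrightarrow>
      (\<forall>x. functional (\<alpha> x)) \<and> (\<forall>y. functional (\<lambda>x. \<alpha> x y)) \<and>
      (\<forall>f. functional f \<longrightarrow> (\<forall>x. \<alpha> (f \<rightharpoonup> x) = f \<star> \<alpha> x \<and> \<alpha> (x \<leftharpoonup> f) = \<alpha> x \<star> f))"
    unfolding dual_bimodule_hom_def dual_space_def lin[symmetric] by auto
  also have "\<dots> \<longleftrightarrow> balanced_form \<alpha>"
    unfolding balanced_form_def by (cases "\<forall>y. functional (\<lambda>x. \<alpha> x y)") (auto simp: act)
  finally show ?thesis .
qed

lemma balanced_form_functional:
  assumes "balanced_form B"
  shows "functional (B x)" "functional (\<lambda>x. B x y)"
  using assms by (auto simp: balanced_form_def)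

lemma balanced_form_left:
  "balanced_form B \<Longrightarrow> functional f \<Longrightarrow>
    sweedler x (\<lambda>a b. f b * B a y) = sweedler y (\<lambda>c d. f c * B x d)"
  and balanced_form_right:
  "balanced_form B \<Longrightarrow> functional f \<Longrightarrow>
    sweedler x (\<lambda>a b. f a * B b y) = sweedler y (\<lambda>c d. B x c * f d)"
  by (simp_all add: balanced_form_def)

text \<open>
  Regarded as a map into \<open>C\<^sup>*\<close>, the form sends both \<open>B x \<rightharpoonup> y\<close> and \<open>x \<leftharpoonup> B y\<close> to \<open>B x \<star> B y\<close>, so these two
  elements agree when it is injective. Their values under the counit are \<open>B x y\<close> and \<open>B y x\<close>.
\<close>

lemma balanced_form_symmetric:
  assumes B: "balanced_form B" and inj: "inj B"
  shows "B x y = B y x"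
proof -
  note lin = balanced_form_functional[OF B]
  have "B (B x \<rightharpoonup> y) = B (x \<leftharpoonup> B y)"
    using functional_left_act[OF lin(2), of "B x" y] functional_right_act[OF lin(2), of x "B y"]
    by (simp add: fun_eq_iff balanced_form_left[OF B lin(1)] balanced_form_right[OF B lin(1)])
  then have "B x \<rightharpoonup> y = x \<leftharpoonup> B y"
    using inj by (simp add: inj_def)
  then show ?thesis
    using counit_left_act[OF lin(1), of x y] counit_right_act[OF lin(1), of x y] by simp
qed

end


section \<open>The antipode\<close>

context hopf_algebra
begin

notation antipode (\<open>S\<close>)

lemma endomorphism_mult_right [linearity]: "endomorphism g \<Longrightarrow> endomorphism (\<lambda>x. g x * c)"
  and endomorphism_mult_left [linearity]: "endomorphism g \<Longrightarrow> endomorphism (\<lambda>x. c * g x)"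
  by (simp_all add: endomorphism_iff distrib_left distrib_right scale_mult_left scale_mult_right)

lemma endomorphism_antipode [linearity]: "endomorphism g \<Longrightarrow> endomorphism (\<lambda>x. S (g x))"
  by (rule endomorphism_comp[OF antipode_linear])

lemma sweedler_one:
  assumes "\<And>b. functional (\<lambda>a. F a b)" "\<And>a. functional (F a)"
  shows "sweedler 1 F = F 1 1"
  unfolding sweedler_def by (subst tensor2_eq_sum[OF comult_one assms]) simp

lemma sweedler_mult:
  assumes "\<And>b. functional (\<lambda>a. F a b)" "\<And>a. functional (F a)"
  shows "sweedler (x * y) F = sweedler x (\<lambda>a b. sweedler y (\<lambda>c d. F (a * c) (b * d)))"
  unfolding sweedler_def
  by (subst tensor2_eq_sum[OF comult_mult assms])
    (simp add: case_prod_unfold sum_list_concat_map o_def)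

lemma sweedler_antipode_left:
  "functional f \<Longrightarrow> sweedler x (\<lambda>a b. f (S a * b)) = counit x * f 1"
  using arg_cong[OF antipode_left[of x], of f]
  by (simp add: sweedler_def case_prod_unfold functional_sum_list functional_scale)

lemma sweedler_antipode_right:
  "functional f \<Longrightarrow> sweedler x (\<lambda>a b. f (a * S b)) = counit x * f 1"
  using arg_cong[OF antipode_right[of x], of f]
  by (simp add: sweedler_def case_prod_unfold functional_sum_list functional_scale)

text \<open>
  Both sides are convolution inverses of the multiplication \<open>H \<otimes> H \<rightarrow> H\<close>: the expression
  \<open>S(x\<^sub>1 y\<^sub>1) x\<^sub>2 y\<^sub>2 S(y\<^sub>3) S(x\<^sub>3)\<close> collapses to one side from the right and to the other from the left.
\<close>

lemma antipode_mult: "S (x * y) = S y * S x"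
proof (rule functional_ext)
  fix f assume f: "functional f"
  note [linearity] = f functional_comp[OF f]
  let ?G = "\<lambda>x1 x2 x3 y1 y2 y3. f (S (x1 * y1) * (x2 * y2) * (S y3 * S x3))"
  let ?M = "sweedler x (\<lambda>x1 r. sweedler r (\<lambda>x2 x3. sweedler y (\<lambda>y1 s. sweedler s (\<lambda>y2 y3. ?G x1 x2 x3 y1 y2 y3))))"
  have right: "sweedler s (\<lambda>y2 y3. f (c * (x2 * y2) * (S y3 * d))) = counit s * f (c * x2 * d)" for c d x2 s
    using sweedler_antipode_right[of "\<lambda>h. f (c * x2 * h * d)" s] by (simp add: linearity mult.assoc)
  have left: "sweedler p (\<lambda>x1 x2. sweedler q (\<lambda>y1 y2. f (S (x1 * y1) * (x2 * y2) * d)))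
      = counit p * (counit q * f d)" for p q d
    using sweedler_antipode_left[of "\<lambda>h. f (h * d)" "p * q"]
    by (simp add: sweedler_mult linearity counit_mult)
  have "?M = sweedler x (\<lambda>x1 r. sweedler r (\<lambda>x2 x3. f (S (x1 * y) * x2 * S x3)))"
    by (simp add: right sweedler_counit_right linearity)
  also have "\<dots> = sweedler x (\<lambda>x1 r. counit r * f (S (x1 * y)))"
    using sweedler_antipode_right[of "\<lambda>h. f (c * h)" for c] by (simp add: linearity mult.assoc)
  also have "\<dots> = f (S (x * y))"
    by (simp add: sweedler_counit_right linearity)
  finally have "?M = f (S (x * y))" .
  have "?M = sweedler x (\<lambda>p x3. sweedler p (\<lambda>x1 x2. sweedler y (\<lambda>q y3. sweedler q (\<lambda>y1 y2. ?G x1 x2 x3 y1 y2 y3))))"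
    by (simp only: sweedler_coassoc linearity)
  also have "\<dots> = sweedler x (\<lambda>p x3. sweedler y (\<lambda>q y3. sweedler p (\<lambda>x1 x2. sweedler q (\<lambda>y1 y2. ?G x1 x2 x3 y1 y2 y3))))"
    by (subst (2) sweedler_swap) (rule refl)
  also have "\<dots> = sweedler x (\<lambda>p x3. counit p * sweedler y (\<lambda>q y3. counit q * f (S y3 * S x3)))"
    by (simp only: left sweedler_mult_left)
  also have "\<dots> = f (S y * S x)"
    by (simp add: sweedler_counit_left linearity)
  finally show "f (S (x * y)) = f (S y * S x)"
    using \<open>?M = f (S (x * y))\<close> by simp
qed

lemma antipode_one: "S 1 = 1"
proof (rule functional_ext)
  fix f assume f: "functional f"
  note [linearity] = f functional_comp[OF f]
  show "f (S 1) = f 1"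
    using sweedler_antipode_left[OF f, of 1] by (subst (asm) sweedler_one) (simp_all add: linearity counit_one)
qed

text \<open>
  The antipode reverses the comultiplication. As for products, \<open>\<Delta> \<circ> S\<close> and the flipped
  \<open>(S \<otimes> S) \<circ> \<Delta>\<close> are convolution inverses of \<open>\<Delta>\<close>: the expression
  \<open>\<Delta>(S(x\<^sub>1)) \<Delta>(x\<^sub>2) (S(x\<^sub>4) \<otimes> S(x\<^sub>3))\<close> is collapsed from either end.
\<close>

lemma sweedler_antipode:
  assumes F1: "\<And>b. functional (\<lambda>a. F a b)" and F2: "\<And>a. functional (F a)"
  shows "sweedler (S x) F = sweedler x (\<lambda>a b. F (S b) (S a))"
proof -
  note [linearity] = F1 F2 functional_comp[OF F1] functional_comp[OF F2]
  let ?N = "sweedler x (\<lambda>x1 r. sweedler r (\<lambda>x2 u. sweedler u (\<lambda>x3 v. sweedler v (\<lambda>x4 x5.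
    sweedler (S x1) (\<lambda>p q. F (p * x2 * S x5) (q * x3 * S x4))))))"
  have a1: "sweedler m (\<lambda>x3 x4. sweedler y (\<lambda>p q. F (p * c) (q * x3 * S x4)))
      = counit m * sweedler y (\<lambda>p q. F (p * c) q)" for m y c
    using sweedler_antipode_right[of "\<lambda>h. sweedler y (\<lambda>p q. F (p * c) (q * h))" m]
    by (simp add: linearity mult.assoc)
  have a2: "sweedler r (\<lambda>x2 u. sweedler y (\<lambda>p q. F (p * x2 * S u) q)) = counit r * sweedler y F" for r y
    using sweedler_antipode_right[of "\<lambda>h. sweedler y (\<lambda>p q. F (p * h) q)" r]
    by (simp add: linearity mult.assoc)
  have "?N = sweedler x (\<lambda>x1 r. sweedler r (\<lambda>x2 u. sweedler u (\<lambda>m x5. sweedler m (\<lambda>x3 x4.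
    sweedler (S x1) (\<lambda>p q. F (p * (x2 * S x5)) (q * x3 * S x4))))))"
    by (simp only: sweedler_coassoc linearity mult.assoc)
  also have "\<dots> = sweedler x (\<lambda>x1 r. sweedler r (\<lambda>x2 u. sweedler (S x1) (\<lambda>p q. F (p * x2 * S u) q)))"
    by (simp only: a1) (simp add: sweedler_counit_left linearity mult.assoc)
  also have "\<dots> = sweedler (S x) F"
    by (simp only: a2) (simp add: sweedler_counit_right linearity)
  finally have N1: "?N = sweedler (S x) F" .
  have b: "sweedler l (\<lambda>x1 m. sweedler m (\<lambda>x2 x3. sweedler (S x1) (\<lambda>p q. F (p * x2 * c) (q * x3 * d))))
      = counit l * F c d" for l c d
  proof -
    have "sweedler l (\<lambda>x1 m. sweedler m (\<lambda>x2 x3. sweedler (S x1) (\<lambda>p q. F (p * x2 * c) (q * x3 * d))))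
      = sweedler l (\<lambda>x1 m. sweedler (S x1 * m) (\<lambda>p q. F (p * c) (q * d)))"
      by (simp only: sweedler_mult linearity sweedler_swap[where x = m and y = "S x1" for m x1])
    also have "\<dots> = counit l * sweedler 1 (\<lambda>p q. F (p * c) (q * d))"
      by (rule sweedler_antipode_left) (intro linearity)
    also have "sweedler 1 (\<lambda>p q. F (p * c) (q * d)) = F c d"
      by (subst sweedler_one) (simp_all add: linearity)
    finally show ?thesis .
  qed
  have swap: "sweedler l (\<lambda>x1 m. sweedler m (\<lambda>x2 x3. sweedler v (K x1 x2 x3)))
      = sweedler v (\<lambda>x4 x5. sweedler l (\<lambda>x1 m. sweedler m (\<lambda>x2 x3. K x1 x2 x3 x4 x5)))" for l v K
    by (simp only: sweedler_swap[where y = v])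
  have "?N = sweedler x (\<lambda>x1 r. sweedler r (\<lambda>m v. sweedler m (\<lambda>x2 x3. sweedler v (\<lambda>x4 x5.
    sweedler (S x1) (\<lambda>p q. F (p * x2 * S x5) (q * x3 * S x4))))))"
    by (simp only: sweedler_coassoc linearity)
  also have "\<dots> = sweedler x (\<lambda>l v. sweedler l (\<lambda>x1 m. sweedler m (\<lambda>x2 x3. sweedler v (\<lambda>x4 x5.
    sweedler (S x1) (\<lambda>p q. F (p * x2 * S x5) (q * x3 * S x4))))))"
    by (simp only: sweedler_coassoc linearity)
  also have "\<dots> = sweedler x (\<lambda>l v. sweedler v (\<lambda>x4 x5. sweedler l (\<lambda>x1 m. sweedler m (\<lambda>x2 x3.
    sweedler (S x1) (\<lambda>p q. F (p * x2 * S x5) (q * x3 * S x4))))))"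
    by (simp only: swap)
  also have "\<dots> = sweedler x (\<lambda>l v. counit l * sweedler v (\<lambda>x4 x5. F (S x5) (S x4)))"
    by (simp only: b sweedler_mult_left)
  also have "\<dots> = sweedler x (\<lambda>a b. F (S b) (S a))"
    by (simp add: sweedler_counit_left linearity)
  finally show ?thesis
    using N1 by simp
qed


section \<open>Integrals\<close>


abbreviation left_integral :: "('h \<Rightarrow> 'k) \<Rightarrow> bool" where
  "left_integral t \<equiv> t \<in> left_integrals scale comult"

abbreviation right_integral :: "('h \<Rightarrow> 'k) \<Rightarrow> bool" where
  "right_integral t \<equiv> t \<in> right_integrals scale comult"

lemma left_integral_iff: "left_integral t \<longleftrightarrow>
    functional t \<and> (\<forall>f x. functional f \<longrightarrow> sweedler x (\<lambda>a b. f a * t b) = f 1 * t x)"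
  by (auto simp: left_integrals_def dual_space_def fun_eq_iff convolution_sweedler)

lemma right_integral_iff: "right_integral t \<longleftrightarrow>
    functional t \<and> (\<forall>f x. functional f \<longrightarrow> sweedler x (\<lambda>a b. t a * f b) = f 1 * t x)"
  by (auto simp: right_integrals_def dual_space_def fun_eq_iff convolution_sweedler)

lemma left_integral_functional: "left_integral t \<Longrightarrow> functional t"
  and sweedler_left_integral:
    "left_integral t \<Longrightarrow> functional f \<Longrightarrow> sweedler x (\<lambda>a b. f a * t b) = f 1 * t x"
  by (simp_all add: left_integral_iff)

lemma right_integral_functional: "right_integral t \<Longrightarrow> functional t"
  and sweedler_right_integral:
    "right_integral t \<Longrightarrow> functional f \<Longrightarrow> sweedler x (\<lambda>a b. t a * f b) = f 1 * t x"
  by (simp_all add: right_integral_iff)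

text \<open>
  The next four lemmas move a Sweedler component from one factor of the argument of an integral to
  the other. Each inserts \<open>\<epsilon>\<close> as \<open>S(c\<^sub>1) c\<^sub>2\<close> or \<open>c\<^sub>1 S(c\<^sub>2)\<close> next to the component to be moved and then
  applies the integral property to the whole product. For \<open>x S(y)\<close> a left integral leaves
  \<open>y\<^sub>2\<close> behind but a right integral \<open>S\<^sup>2(y\<^sub>1)\<close>, because \<open>S\<close> reverses the order of components; this is
  where the square of the antipode enters.
\<close>

lemma left_integral_mult_antipode:
  assumes t: "left_integral t" and f: "functional f"
  shows "sweedler x (\<lambda>a b. f a * t (b * S y)) = sweedler y (\<lambda>c d. f d * t (x * S c))"
proof -
  note ft = left_integral_functional[OF t]
  note [linearity] = f functional_comp[OF f] ft functional_comp[OF ft]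
  have expand: "f d * t (x * S c)
      = sweedler c (\<lambda>c1 c2. sweedler x (\<lambda>a b. f (a * (S c2 * d)) * t (b * S c1)))" for c d
    using sweedler_left_integral[OF t, of "\<lambda>h. f (h * d)" "x * S c"]
    by (simp add: linearity sweedler_mult sweedler_antipode mult.assoc sweedler_swap[where x = x and y = c])
  have collapse: "sweedler q (\<lambda>c d. sweedler x (\<lambda>a b. f (a * (S c * d)) * t (b * e)))
      = counit q * sweedler x (\<lambda>a b. f a * t (b * e))" for q e
    using sweedler_antipode_left[of "\<lambda>h. sweedler x (\<lambda>a b. f (a * h) * t (b * e))" q]
    by (simp add: linearity)
  have "sweedler y (\<lambda>c d. f d * t (x * S c))
      = sweedler y (\<lambda>c1 q. sweedler q (\<lambda>c2 d. sweedler x (\<lambda>a b. f (a * (S c2 * d)) * t (b * S c1))))"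
    by (simp only: expand sweedler_coassoc linearity)
  also have "\<dots> = sweedler x (\<lambda>a b. f a * t (b * S y))"
    by (simp only: collapse) (simp add: sweedler_counit_right linearity)
  finally show ?thesis
    by simp
qed

lemma right_integral_mult_antipode:
  assumes t: "right_integral t" and f: "functional f"
  shows "sweedler x (\<lambda>a b. t (a * S y) * f b) = sweedler y (\<lambda>c d. f (S (S c)) * t (x * S d))"
proof -
  note ft = right_integral_functional[OF t]
  note [linearity] = f functional_comp[OF f] ft functional_comp[OF ft]
  have expand: "f (S (S c)) * t (x * S d)
      = sweedler d (\<lambda>d1 d2. sweedler x (\<lambda>a b. t (a * S d2) * f (b * S (S c * d1))))" for c d
    using sweedler_right_integral[OF t, of "\<lambda>h. f (h * S (S c))" "x * S d"]
    by (simp add: linearity sweedler_mult sweedler_antipode mult.assoc antipode_mult sweedler_swap[where x = x and y = d])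
  have collapse: "sweedler p (\<lambda>c d1. sweedler x (\<lambda>a b. t (a * e) * f (b * S (S c * d1))))
      = counit p * sweedler x (\<lambda>a b. t (a * e) * f b)" for p e
    using sweedler_antipode_left[of "\<lambda>h. sweedler x (\<lambda>a b. t (a * e) * f (b * S h))" p]
    by (simp add: linearity antipode_one)
  have "sweedler y (\<lambda>c d. f (S (S c)) * t (x * S d))
      = sweedler y (\<lambda>p d2. sweedler p (\<lambda>c d1. sweedler x (\<lambda>a b. t (a * S d2) * f (b * S (S c * d1)))))"
    by (simp only: expand sweedler_coassoc linearity)
  also have "\<dots> = sweedler x (\<lambda>a b. t (a * S y) * f b)"
    by (simp only: collapse) (simp add: sweedler_counit_left linearity)
  finally show ?thesis
    by simp
qed

lemma left_integral_mult:
  assumes s: "left_integral s" and f: "functional f"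
  shows "sweedler y (\<lambda>c d. f c * s (x * d)) = sweedler x (\<lambda>a b. f (S a) * s (b * y))"
proof -
  note fs = left_integral_functional[OF s]
  note [linearity] = f functional_comp[OF f] fs functional_comp[OF fs]
  have expand: "f (S a) * s (b * y)
      = sweedler b (\<lambda>b1 b2. sweedler y (\<lambda>c d. f (S a * b1 * c) * s (b2 * d)))" for a b
    using sweedler_left_integral[OF s, of "\<lambda>h. f (S a * h)" "b * y"]
    by (simp add: linearity sweedler_mult mult.assoc)
  have collapse: "sweedler p (\<lambda>a b1. sweedler y (\<lambda>c d. f (S a * b1 * c) * s (e * d)))
      = counit p * sweedler y (\<lambda>c d. f c * s (e * d))" for p e
    using sweedler_antipode_left[of "\<lambda>h. sweedler y (\<lambda>c d. f (h * c) * s (e * d))" p]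
    by (simp add: linearity)
  have "sweedler x (\<lambda>a b. f (S a) * s (b * y))
      = sweedler x (\<lambda>p b2. sweedler p (\<lambda>a b1. sweedler y (\<lambda>c d. f (S a * b1 * c) * s (b2 * d))))"
    by (simp only: expand sweedler_coassoc linearity)
  also have "\<dots> = sweedler y (\<lambda>c d. f c * s (x * d))"
    by (simp only: collapse) (simp add: sweedler_counit_left linearity)
  finally show ?thesis
    by simp
qed

lemma right_integral_mult:
  assumes s: "right_integral s" and f: "functional f"
  shows "sweedler x (\<lambda>a b. s (a * y) * f b) = sweedler y (\<lambda>c d. s (x * c) * f (S d))"
proof -
  note fs = right_integral_functional[OF s]
  note [linearity] = f functional_comp[OF f] fs functional_comp[OF fs]
  have expand: "s (x * c) * f (S d)
      = sweedler c (\<lambda>c1 c2. sweedler x (\<lambda>a b. s (a * c1) * f (b * (c2 * S d))))" for c d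
    using sweedler_right_integral[OF s, of "\<lambda>h. f (h * S d)" "x * c"]
    by (simp add: linearity sweedler_mult mult.assoc mult.commute[of "s (x * c)"] sweedler_swap[where x = x and y = c])
  have collapse: "sweedler q (\<lambda>c2 d. sweedler x (\<lambda>a b. s (a * e) * f (b * (c2 * S d))))
      = counit q * sweedler x (\<lambda>a b. s (a * e) * f b)" for q e
    using sweedler_antipode_right[of "\<lambda>h. sweedler x (\<lambda>a b. s (a * e) * f (b * h))" q]
    by (simp add: linearity)
  have "sweedler y (\<lambda>c d. s (x * c) * f (S d))
      = sweedler y (\<lambda>c1 q. sweedler q (\<lambda>c2 d. sweedler x (\<lambda>a b. s (a * c1) * f (b * (c2 * S d)))))"
    by (simp only: expand sweedler_coassoc linearity)
  also have "\<dots> = sweedler x (\<lambda>a b. s (a * y) * f b)"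
    by (simp only: collapse) (simp add: sweedler_counit_right linearity)
  finally show ?thesis
    by simp
qed

text \<open>
  The \<open>y\<close> with \<open>t(x S(y)) = 0\<close> for all \<open>x\<close> form a right ideal \<open>K\<close> which is also a right coideal, so
  for \<open>y \<in> K\<close> the element \<open>\<Sum> y\<^sub>1 S(y\<^sub>2) = \<epsilon>(y) 1\<close> is in \<open>K\<close> and \<open>\<epsilon>(y)\<close> vanishes, as \<open>t \<noteq> 0\<close>.
  Carrying along a third component \<open>f(y\<^sub>3)\<close> gives \<open>f(y) = 0\<close>. Here \<open>\<Delta>(y) \<in> K \<otimes> H\<close> is used in the
  form of \<open>sweedler_diagonal_zero\<close>.
\<close>

lemma left_integral_nondegenerate:
  assumes t: "left_integral t" and z: "t z \<noteq> 0" and y: "\<And>x. t (x * S y) = 0"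
  shows "y = 0"
proof (rule functional_ext)
  fix f assume f: "functional f"
  note ft = left_integral_functional[OF t]
  note [linearity] = f functional_comp[OF f] ft functional_comp[OF ft]
  define F where "F a b = sweedler b (\<lambda>b1 b2. t (z * S (S b1) * S a) * f b2)" for a b
  have "sweedler y F = 0"
  proof (rule sweedler_diagonal_zero)
    show "functional (F a)" for a
      unfolding F_def by (intro linearity)
    fix b' g assume g: "functional g"
    have "sweedler y (\<lambda>a b. g b * t (h * S a)) = 0" for h
      using left_integral_mult_antipode[OF t g, of h y] by (simp add: y)
    then have "sweedler b' (\<lambda>b1 b2. f b2 * sweedler y (\<lambda>a b. g b * t (z * S (S b1) * S a))) = 0"
      by simp
    then show "sweedler y (\<lambda>a b. F a b' * g b) = 0"
      unfolding F_def sweedler_mult_left[symmetric] sweedler_mult_right[symmetric]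
      by (subst sweedler_swap) (simp add: mult_ac)
  qed
  moreover have "sweedler y F = sweedler y (\<lambda>p c. sweedler p (\<lambda>a b. t (z * S (S b) * S a) * f c))"
    unfolding F_def by (simp only: sweedler_coassoc linearity)
  moreover have "sweedler p (\<lambda>a b. t (z * S (S b) * S a) * f c) = counit p * (t z * f c)" for p c
    using sweedler_antipode_right[of "\<lambda>h. t (z * S h) * f c" p]
    by (simp add: linearity antipode_one antipode_mult mult.assoc)
  ultimately have "t z * f y = 0"
    by (simp add: sweedler_counit_left linearity)
  then show "f y = f 0"
    using z functional_zero[OF f] by simp
qed

lemma antipode_diff: "S (x - y) = S x - S y"
  using antipode_linear unfolding endomorphism_iff by (metis add_diff_cancel diff_add_cancel)

lemma inj_antipode:
  assumes t: "left_integral t" and z: "t z \<noteq> 0"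
  shows "inj S"
proof (rule injI)
  fix x y assume "S x = S y"
  then have "x - y = 0"
    using functional_zero[OF left_integral_functional[OF t]]
    by (intro left_integral_nondegenerate[OF t z]) (simp add: antipode_diff)
  then show "x = y"
    by simp
qed

text \<open>
  The mirror image: the \<open>x\<close> with \<open>t(x H) = 0\<close> form a right ideal and left coideal, and
  \<open>\<Sum> x\<^sub>2 S\<^sup>-\<^sup>1(x\<^sub>1) = \<epsilon>(x) 1\<close>. The inverse of \<open>S\<close> is \<open>S \<circ> \<psi>\<close>, where \<open>\<psi>\<close> is a right inverse of \<open>S\<^sup>2\<close>.
\<close>

lemma left_integral_nondegenerate':
  assumes t: "left_integral t" and z: "t z \<noteq> 0" and x: "\<And>y. t (x * S y) = 0"
    and \<psi>: "endomorphism \<psi>" "\<And>h. S (S (\<psi> h)) = h"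
  shows "x = 0"
proof (rule functional_ext)
  fix f assume f: "functional f"
  note ft = left_integral_functional[OF t]
  note [linearity] = f functional_comp[OF f] ft functional_comp[OF ft] endomorphism_comp[OF \<psi>(1)]
  \<comment> \<open>The inverse antipode law; it is checked after applying the injective map \<open>S\<close>.\<close>
  have twisted: "sweedler q (\<lambda>a b. g (b * S (\<psi> a))) = counit q * g 1" if g: "functional g" for g q
  proof -
    define e where "e = (\<Sum>(a, b)\<leftarrow>comult q. b * S (\<psi> a))"
    have f_e: "f e = sweedler q (\<lambda>a b. f (b * S (\<psi> a)))" if "functional f" for f
      using that by (simp add: e_def sweedler_def functional_sum_list case_prod_unfold)
    have "S e = S (scale (counit q) 1)"
    proof (rule functional_ext)
      fix f assume f: "functional f"
      note [linearity] = f functional_comp[OF f]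
      have "f (S e) = sweedler q (\<lambda>a b. f (a * S b))"
        using f_e[of "\<lambda>h. f (S h)"] by (simp add: linearity antipode_mult \<psi>)
      also have "\<dots> = f (S (scale (counit q) 1))"
        using antipode_linear f
        by (simp add: sweedler_antipode_right endomorphism_iff functional_scale antipode_one)
      finally show "f (S e) = f (S (scale (counit q) 1))" .
    qed
    then have "e = scale (counit q) 1"
      using inj_antipode[OF t z] by (simp add: inj_def)
    then show ?thesis
      using f_e[OF g] g by (simp add: functional_scale)
  qed
  \<comment> \<open>An \<open>S\<close>-preimage of \<open>z\<close>, so that \<open>S (w * \<psi> a) = S (\<psi> a) * z\<close>.\<close>
  define w where "w = S (\<psi> z)"
  define F where "F a b = sweedler a (\<lambda>a1 a2. f a1 * t (b * S (w * \<psi> a2)))" for a b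
  have "sweedler x F = 0"
  proof (rule sweedler_diagonal_zero')
    show "functional (\<lambda>a. F a b)" for b
      unfolding F_def by (intro linearity)
    fix a' g assume g: "functional g"
    have "sweedler x (\<lambda>a b. g a * t (b * S h)) = 0" for h
      using left_integral_mult_antipode[OF t g, of x h] by (simp add: x)
    then have "sweedler a' (\<lambda>a1 a2. f a1 * sweedler x (\<lambda>a b. g a * t (b * S (w * \<psi> a2)))) = 0"
      by simp
    then show "sweedler x (\<lambda>a b. g a * F a' b) = 0"
      unfolding F_def sweedler_mult_left[symmetric] sweedler_mult_right[symmetric]
      by (subst sweedler_swap) (simp add: mult_ac)
  qed
  moreover have "sweedler x F = sweedler x (\<lambda>a1 q. sweedler q (\<lambda>a2 b. f a1 * t (b * S (w * \<psi> a2))))"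
    unfolding F_def by (simp only: sweedler_coassoc linearity)
  moreover have "sweedler q (\<lambda>a2 b. f c * t (b * S (w * \<psi> a2))) = counit q * (f c * t z)" for q c
    using twisted[of "\<lambda>h. f c * t (h * z)" q]
    by (simp add: linearity antipode_mult mult.assoc w_def \<psi>)
  ultimately have "f x * t z = 0"
    by (simp add: sweedler_counit_right linearity)
  then show "f x = f 0"
    using z functional_zero[OF f] by simp
qed

text \<open>
  Evaluating \<open>\<Sum> t(y\<^sub>1) s(x y\<^sub>2) = \<Sum> t(S(x\<^sub>1)) s(x\<^sub>2 y)\<close> with the integral properties of \<open>t\<close> and \<open>t \<circ> S\<close>
  gives \<open>s(x) t(y) = t(S(x)) s(y)\<close> for a left integral \<open>s\<close>, and similarly for a right one. The choice
  \<open>s = t\<close> then shows \<open>t \<circ> S = t\<close>.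
\<close>

lemma two_sided_integral_unique:
  assumes l: "left_integral t" and r: "right_integral t" and z: "t z \<noteq> 0"
    and s: "left_integral s \<or> right_integral s"
  shows "s x * t y = t x * s y"
proof -
  note ft = left_integral_functional[OF l]
  note [linearity] = ft functional_comp[OF ft]
  have inj: "inj S"
    by (rule inj_antipode[OF l z])
  \<comment> \<open>The functional \<open>t \<circ> S\<close> is again a two-sided integral. The integral property of \<open>t\<close> at \<open>S x\<close> gives
    the required identities only after applying \<open>S\<close>, which is injective.\<close>
  have tS_right: "sweedler x (\<lambda>a b. t (S a) * f b) = f 1 * t (S x)"
    and tS_left: "sweedler x (\<lambda>a b. f a * t (S b)) = f 1 * t (S x)" if f: "functional f" for f x
  proof -
    have S1: "S (scale c 1) = scale c 1" for c
      using antipode_linear by (simp add: endomorphism_iff antipode_one)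
    define e where "e = right_act scale comult x (\<lambda>a. t (S a))"
    define e' where "e' = left_act scale comult (\<lambda>b. t (S b)) x"
    have "S e = S (scale (t (S x)) 1)"
    proof (rule functional_ext)
      fix g assume g: "functional g"
      note [linearity] = g functional_comp[OF g]
      show "g (S e) = g (S (scale (t (S x)) 1))"
        using sweedler_left_integral[OF l g, of "S x"]
          functional_right_act[of "\<lambda>h. g (S h)" x "\<lambda>a. t (S a)"]
        by (simp add: sweedler_antipode linearity e_def S1 functional_scale[OF g] mult.commute)
    qed
    then have "e = scale (t (S x)) 1"
      using inj by (simp add: inj_def)
    then show "sweedler x (\<lambda>a b. t (S a) * f b) = f 1 * t (S x)"
      using functional_right_act[OF f, of x "\<lambda>a. t (S a)"] by (simp add: e_def functional_scale[OF f] mult.commute)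
    have "S e' = S (scale (t (S x)) 1)"
    proof (rule functional_ext)
      fix g assume g: "functional g"
      note [linearity] = g functional_comp[OF g]
      show "g (S e') = g (S (scale (t (S x)) 1))"
        using sweedler_right_integral[OF r g, of "S x"]
          functional_left_act[of "\<lambda>h. g (S h)" "\<lambda>a. t (S a)" x]
        by (simp add: sweedler_antipode linearity e'_def S1 functional_scale[OF g] mult.commute)
    qed
    then have "e' = scale (t (S x)) 1"
      using inj by (simp add: inj_def)
    then show "sweedler x (\<lambda>a b. f a * t (S b)) = f 1 * t (S x)"
      using functional_left_act[OF f, of "\<lambda>a. t (S a)" x] by (simp add: e'_def functional_scale[OF f] mult.commute)
  qed
  have left: "s x * t y = t (S x) * s y" if s: "left_integral s" for s x y
  proof -
    note fs = left_integral_functional[OF s]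
    note [linearity] = functional_comp[OF fs]
    show ?thesis
      using left_integral_mult[OF s ft, of y x]
        sweedler_right_integral[OF r, of "\<lambda>h. s (x * h)" y] tS_right[of "\<lambda>h. s (h * y)" x]
      by (simp add: linearity mult.commute)
  qed
  have right: "s y * t x = s x * t (S y)" if s: "right_integral s" for s x y
  proof -
    note fs = right_integral_functional[OF s]
    note [linearity] = functional_comp[OF fs]
    show ?thesis
      using right_integral_mult[OF s ft, of x y]
        sweedler_left_integral[OF l, of "\<lambda>h. s (h * y)" x] tS_left[of "\<lambda>h. s (x * h)" y]
      by (simp add: linearity)
  qed
  have tS: "t (S x) = t x" for x
    using left[OF l, of x z] z by simp
  show ?thesis
    using s left[of s x y] right[of s x y] by (auto simp: tS mult.commute)
qed

lemma two_sided_integral_unimodular: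
  assumes l: "left_integral t" and r: "right_integral t" and z: "t z \<noteq> 0"
  shows "unimodular scale comult"
proof -
  have multiple: "s = (\<lambda>x. s z / t z * t x)" if "left_integral s \<or> right_integral s" for s
    using two_sided_integral_unique[OF l r z that, of _ z] z by (auto simp: field_simps fun_eq_iff)
  have "sweedler x (\<lambda>a b. f a * (c * t b)) = c * sweedler x (\<lambda>a b. f a * t b)"
    "sweedler x (\<lambda>a b. c * t a * f b) = c * sweedler x (\<lambda>a b. t a * f b)" for f c x
    by (simp_all add: sweedler_mult_left[symmetric] mult.left_commute[of _ c] mult.assoc)
  then have "left_integral (\<lambda>x. c * t x)" "right_integral (\<lambda>x. c * t x)" for c
    using l r unfolding left_integral_iff right_integral_iff
    by (auto simp: functional_mult_left)
  then have "left_integral s \<longleftrightarrow> right_integral s" for s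
    using multiple[of s] by metis
  then have "left_integrals scale comult = right_integrals scale comult"
    by auto
  moreover have "t \<noteq> (\<lambda>x. 0)"
    using z by auto
  ultimately show ?thesis
    unfolding unimodular_def using l by blast
qed


section \<open>Balanced forms on a Hopf algebra with a two-sided integral\<close>

definition twisted_form :: "('h \<Rightarrow> 'k) \<Rightarrow> ('h \<Rightarrow> 'k) \<Rightarrow> 'h \<Rightarrow> 'h \<Rightarrow> 'k" where
  "twisted_form t w x y = t (x * S (y \<leftharpoonup> w))"

lemma twisted_form_sweedler:
  "functional t \<Longrightarrow> twisted_form t w x y = sweedler y (\<lambda>c d. w c * t (x * S d))"
  using functional_right_act[of "\<lambda>h. t (x * S h)" y w]
  by (simp add: twisted_form_def functional_comp[of t] linearity)

lemma twisted_form_functional: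
  assumes t: "functional t" and w: "functional w"
  shows "functional (twisted_form t w x)" "functional (\<lambda>x. twisted_form t w x y)"
  unfolding twisted_form_def
  by (intro functional_comp[OF t] linearity endomorphism_right_act[OF w])+

lemma twisted_form_right:
  assumes t: "left_integral t" and w: "functional w" and f: "functional f"
  shows "sweedler x (\<lambda>a b. f a * twisted_form t w b y) = sweedler y (\<lambda>c d. twisted_form t w x c * f d)"
proof -
  note ft = left_integral_functional[OF t]
  note [linearity] = f functional_comp[OF f] ft functional_comp[OF ft] w
  have "sweedler x (\<lambda>a b. f a * twisted_form t w b y)
      = sweedler x (\<lambda>a b. sweedler y (\<lambda>p q. w p * (f a * t (b * S q))))"
    by (simp add: twisted_form_sweedler[OF ft] sweedler_mult_left[symmetric] mult.left_commute)
  also have "\<dots> = sweedler y (\<lambda>p q. w p * sweedler x (\<lambda>a b. f a * t (b * S q)))"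
    by (subst sweedler_swap) (simp only: sweedler_mult_left)
  also have "\<dots> = sweedler y (\<lambda>p q. sweedler q (\<lambda>c d. w p * t (x * S c) * f d))"
    by (simp only: left_integral_mult_antipode[OF t f] sweedler_mult_left[symmetric])
      (simp only: mult.assoc mult.commute[of "f _"])
  also have "\<dots> = sweedler y (\<lambda>l d. sweedler l (\<lambda>p c. w p * t (x * S c) * f d))"
    by (simp only: sweedler_coassoc linearity)
  also have "\<dots> = sweedler y (\<lambda>c d. twisted_form t w x c * f d)"
    by (simp add: twisted_form_sweedler[OF ft] sweedler_mult_right)
  finally show ?thesis .
qed

text \<open>
  The two sides of the remaining balance condition, brought to a common shape. They differ only
  in \<open>S\<^sup>2(l \<leftharpoonup> w)\<close> against \<open>w \<rightharpoonup> l\<close>.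
\<close>

lemma twisted_form_left:
  assumes t: "right_integral t" and w: "functional w" and f: "functional f"
  shows "sweedler x (\<lambda>a b. f b * twisted_form t w a y) =
      sweedler y (\<lambda>l d. f (S (S (l \<leftharpoonup> w))) * t (x * S d))"
    and "sweedler y (\<lambda>c d. f c * twisted_form t w x d) =
      sweedler y (\<lambda>l d. f (w \<rightharpoonup> l) * t (x * S d))"
proof -
  note ft = right_integral_functional[OF t]
  note [linearity] = f functional_comp[OF f] ft functional_comp[OF ft] w
  have fSS: "f (S (S (l \<leftharpoonup> w))) = sweedler l (\<lambda>p c. w p * f (S (S c)))" for l
    using functional_right_act[of "\<lambda>h. f (S (S h))" l w] by (simp add: linearity)
  have "sweedler x (\<lambda>a b. f b * twisted_form t w a y)
      = sweedler x (\<lambda>a b. sweedler y (\<lambda>p q. w p * (t (a * S q) * f b)))"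
    by (simp add: twisted_form_sweedler[OF ft] sweedler_mult_left[symmetric] mult_ac)
  also have "\<dots> = sweedler y (\<lambda>p q. w p * sweedler x (\<lambda>a b. t (a * S q) * f b))"
    by (subst sweedler_swap) (simp only: sweedler_mult_left)
  also have "\<dots> = sweedler y (\<lambda>p q. sweedler q (\<lambda>c d. w p * f (S (S c)) * t (x * S d)))"
    by (simp only: right_integral_mult_antipode[OF t f] sweedler_mult_left mult.assoc)
  also have "\<dots> = sweedler y (\<lambda>l d. sweedler l (\<lambda>p c. w p * f (S (S c)) * t (x * S d)))"
    by (simp only: sweedler_coassoc linearity)
  also have "\<dots> = sweedler y (\<lambda>l d. f (S (S (l \<leftharpoonup> w))) * t (x * S d))"
    by (simp only: fSS sweedler_mult_right)
  finally show "sweedler x (\<lambda>a b. f b * twisted_form t w a y) =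
      sweedler y (\<lambda>l d. f (S (S (l \<leftharpoonup> w))) * t (x * S d))" .
  have "sweedler y (\<lambda>c d. f c * twisted_form t w x d)
      = sweedler y (\<lambda>c q. sweedler q (\<lambda>p d. w p * f c * t (x * S d)))"
    by (simp add: twisted_form_sweedler[OF ft] sweedler_mult_left[symmetric] mult_ac)
  also have "\<dots> = sweedler y (\<lambda>l d. sweedler l (\<lambda>c p. w p * f c * t (x * S d)))"
    by (simp only: sweedler_coassoc linearity)
  also have "\<dots> = sweedler y (\<lambda>l d. f (w \<rightharpoonup> l) * t (x * S d))"
    by (simp only: functional_left_act[OF f] sweedler_mult_right)
  finally show "sweedler y (\<lambda>c d. f c * twisted_form t w x d) =
      sweedler y (\<lambda>l d. f (w \<rightharpoonup> l) * t (x * S d))" .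
qed

text \<open>
  For the direction from left to right, the difference \<open>D\<close> of the two functionals in
  \<open>twisted_form_left\<close> satisfies \<open>t(x S(y \<leftharpoonup> D)) = 0\<close> for all \<open>x\<close>, so \<open>y \<leftharpoonup> D = 0\<close> by nondegeneracy.
\<close>

lemma balanced_twisted_form_iff:
  assumes l: "left_integral t" and r: "right_integral t" and z: "t z \<noteq> 0" and w: "functional w"
  shows "balanced_form (twisted_form t w) \<longleftrightarrow> (\<forall>x. S (S (x \<leftharpoonup> w)) = w \<rightharpoonup> x)"
proof
  assume "\<forall>x. S (S (x \<leftharpoonup> w)) = w \<rightharpoonup> x"
  then show "balanced_form (twisted_form t w)"
    unfolding balanced_form_def
    using twisted_form_functional[OF left_integral_functional[OF l] w] twisted_form_right[OF l w]
      twisted_form_left[OF r w] by simp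
next
  assume B: "balanced_form (twisted_form t w)"
  note ft = left_integral_functional[OF l]
  show "\<forall>x. S (S (x \<leftharpoonup> w)) = w \<rightharpoonup> x"
  proof (intro allI, rule functional_ext)
    fix y f assume f: "functional f"
    define D where "D = (\<lambda>y. f (S (S (y \<leftharpoonup> w))) - f (w \<rightharpoonup> y))"
    have D: "functional D"
      unfolding D_def
      by (intro linearity functional_comp[OF f] endomorphism_left_act endomorphism_right_act w)
    have "t (x * S (y \<leftharpoonup> D)) = 0" for x
    proof -
      have "t (x * S (y \<leftharpoonup> D)) = sweedler y (\<lambda>l d. D l * t (x * S d))"
        using functional_right_act[of "\<lambda>h. t (x * S h)" y D] by (simp add: functional_comp[OF ft] linearity)
      also have "\<dots> = 0"
        using balanced_form_left[OF B f, of x y] twisted_form_left(1)[OF r w f, of x y]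
          twisted_form_left(2)[OF r w f, of y x]
        by (simp add: D_def left_diff_distrib sweedler_diff)
      finally show ?thesis .
    qed
    then have "y \<leftharpoonup> D = 0"
      by (rule left_integral_nondegenerate[OF l z])
    then have "D y = 0"
      using counit_right_act[OF D, of y] functional_zero[OF functional_counit] by simp
    then show "f (S (S (y \<leftharpoonup> w))) = f (w \<rightharpoonup> y)"
      by (simp add: D_def)
  qed
qed

lemma antipode_square_inner_iff:
  assumes "dual_inverses scale comult counit u w"
  shows "(\<forall>h. S (S h) = (w \<rightharpoonup> h) \<leftharpoonup> u) \<longleftrightarrow> (\<forall>x. S (S (x \<leftharpoonup> w)) = w \<rightharpoonup> x)"
proof -
  have u: "functional u" and w: "functional w" and uw: "u \<star> w = counit" and wu: "w \<star> u = counit"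
    using assms by (auto simp: dual_inverses_def dual_space_def)
  show ?thesis
  proof (intro iffI allI)
    fix x assume inner: "\<forall>h. S (S h) = (w \<rightharpoonup> h) \<leftharpoonup> u"
    have "S (S (x \<leftharpoonup> w)) = (w \<rightharpoonup> x) \<leftharpoonup> w \<leftharpoonup> u"
      by (simp add: inner left_act_right_act[OF w w])
    then show "S (S (x \<leftharpoonup> w)) = w \<rightharpoonup> x"
      by (simp add: right_act_right_act[OF w u] wu right_act_counit)
  next
    fix h assume twist: "\<forall>x. S (S (x \<leftharpoonup> w)) = w \<rightharpoonup> x"
    have "h = h \<leftharpoonup> u \<leftharpoonup> w"
      by (simp add: right_act_right_act[OF u w] uw right_act_counit)
    then have "S (S h) = w \<rightharpoonup> (h \<leftharpoonup> u)"
      using twist by metis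
    then show "S (S h) = (w \<rightharpoonup> h) \<leftharpoonup> u"
      by (simp add: left_act_right_act[OF w u])
  qed
qed

text \<open>
  For fixed \<open>y\<close> the functional \<open>B(-, y)\<close> behaves like an element of a right Hopf module with
  coaction \<open>\<Sum> B(-, y\<^sub>1) \<otimes> y\<^sub>2\<close> and action \<open>(f \<cdot> h)(x) = f(x S(h))\<close>. The function \<open>P y\<close> in the proof is
  its projection \<open>\<Sum> f\<^sub>0 \<cdot> S(f\<^sub>1)\<close> to the coinvariants, hence a left integral and a multiple \<open>w(y) t\<close>
  of \<open>t\<close>; the fundamental identity \<open>f = \<Sum> (f\<^sub>0 \<cdot> S(f\<^sub>1)) \<cdot> f\<^sub>2\<close> then becomes \<open>B = B\<^sub>w\<close>.
\<close>

lemma balanced_form_twisted: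
  assumes B: "balanced_form B" and l: "left_integral t" and r: "right_integral t" and z: "t z = 1"
  obtains w where "functional w" "B = twisted_form t w"
proof -
  note lin = balanced_form_functional[OF B]
  note ft = left_integral_functional[OF l]
  note [linearity] = lin functional_comp[OF lin(1)] functional_comp[OF lin(2)]
  define P where "P y x = sweedler y (\<lambda>c d. B (x * S (S d)) c)" for y x
  have P_lin: "functional (P y)" for y
    unfolding P_def by (intro linearity)
  have P_integral: "left_integral (P y)" for y
    unfolding left_integral_iff
  proof (intro conjI allI impI P_lin)
    fix f x assume f: "functional f"
    note [linearity] = f functional_comp[OF f]
    have insert: "B v p * f 1 = sweedler p (\<lambda>c r. sweedler r (\<lambda>y2 y3. B v c * f (y2 * S y3)))" for v p
      by (simp add: sweedler_antipode_right[OF f] sweedler_mult_left linearity)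
        (simp add: sweedler_counit_right linearity mult.left_commute[of _ "counit _"])
    have move: "sweedler q (\<lambda>y1 y2. B (x * S (S d)) y1 * f (y2 * e))
        = sweedler d (\<lambda>d1 d2. sweedler x (\<lambda>a b. f (a * S (S d1) * e) * B (b * S (S d2)) q))" for q d e
      using balanced_form_right[OF B, of "\<lambda>h. f (h * e)" "x * S (S d)" q]
      by (simp add: linearity sweedler_mult sweedler_antipode sweedler_swap[where x = x and y = d])
    have collapse: "sweedler l (\<lambda>y3 d1. sweedler x (\<lambda>a b. f (a * S (S d1) * S y3) * B (b * e) q))
        = counit l * sweedler x (\<lambda>a b. f a * B (b * e) q)" for l e q
      using sweedler_antipode_right[of "\<lambda>h. sweedler x (\<lambda>a b. f (a * S h) * B (b * e) q)" l]
      by (simp add: linearity antipode_mult antipode_one mult.assoc)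
    have "f 1 * P y x = sweedler y (\<lambda>p d. B (x * S (S d)) p * f 1)"
      by (simp add: P_def sweedler_mult_right)
    also have "\<dots> = sweedler y (\<lambda>p d. sweedler p (\<lambda>q y3. sweedler q (\<lambda>y1 y2. B (x * S (S d)) y1 * f (y2 * S y3))))"
      by (simp only: insert sweedler_coassoc linearity)
    also have "\<dots> = sweedler y (\<lambda>p d. sweedler p (\<lambda>q y3. sweedler d (\<lambda>d1 d2.
        sweedler x (\<lambda>a b. f (a * S (S d1) * S y3) * B (b * S (S d2)) q))))"
      by (simp only: move)
    also have "\<dots> = sweedler y (\<lambda>q m. sweedler m (\<lambda>l d2. sweedler l (\<lambda>y3 d1.
        sweedler x (\<lambda>a b. f (a * S (S d1) * S y3) * B (b * S (S d2)) q))))"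
      by (simp only: sweedler_coassoc linearity)
    also have "\<dots> = sweedler y (\<lambda>q m. sweedler x (\<lambda>a b. f a * B (b * S (S m)) q))"
      by (simp only: collapse) (simp add: sweedler_counit_left linearity)
    also have "\<dots> = sweedler x (\<lambda>a b. f a * P y b)"
      unfolding P_def sweedler_mult_left[symmetric] by (rule sweedler_swap)
    finally show "sweedler x (\<lambda>a b. f a * P y b) = f 1 * P y x"
      by simp
  qed
  define w where "w y = P y z" for y
  have P_w: "P y x = w y * t x" for x y
    using two_sided_integral_unique[OF l r, of z "P y" x z] z P_integral by (simp add: w_def mult.commute)
  have w: "functional w"
    unfolding w_def P_def by (intro linearity)
  have collapse: "sweedler q (\<lambda>c d. B (x * S d * S (S c)) e) = counit q * B x e" for q x e
    using sweedler_antipode_left[of "\<lambda>h. B (x * S h) e" q]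
    by (simp add: linearity antipode_mult antipode_one mult.assoc)
  have "B x y = twisted_form t w x y" for x y
  proof -
    have "twisted_form t w x y = sweedler y (\<lambda>p d. sweedler p (\<lambda>c1 c2. B (x * S d * S (S c2)) c1))"
      by (simp add: twisted_form_sweedler[OF ft] P_w[symmetric] P_def)
    also have "\<dots> = sweedler y (\<lambda>c q. counit q * B x c)"
      by (simp only: sweedler_coassoc linearity collapse)
    also have "\<dots> = B x y"
      by (rule sweedler_counit_right[OF lin(1)])
    finally show ?thesis
      by simp
  qed
  then show ?thesis
    using w by (intro that[of w]) (auto simp: fun_eq_iff)
qed

lemma balanced_form_one_integral:
  assumes B: "balanced_form B"
  shows "left_integral (B 1)" "right_integral (B 1)"
proof -
  note lin = balanced_form_functional[OF B]
  have "sweedler 1 (\<lambda>a b. f b * B a y) = f 1 * B 1 y" "sweedler 1 (\<lambda>a b. f a * B b y) = f 1 * B 1 y"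
    if "functional f" for f y
    using that lin by (simp_all add: sweedler_one linearity)
  then show "left_integral (B 1)" "right_integral (B 1)"
    using balanced_form_left[OF B, of _ 1] balanced_form_right[OF B, of _ 1] lin
    by (simp_all add: left_integral_iff right_integral_iff)
qed

lemma symmetric_imp_unimodular_inner:
  assumes B: "balanced_form B" and inj: "inj B"
  shows "unimodular scale comult \<and>
    (\<exists>u w. dual_inverses scale comult counit u w \<and> (\<forall>h. S (S h) = (w \<rightharpoonup> h) \<leftharpoonup> u))"
proof -
  note lin = balanced_form_functional[OF B]
  define t where "t = B 1"
  have l: "left_integral t" and r: "right_integral t"
    using balanced_form_one_integral[OF B] by (simp_all add: t_def)
  note ft = left_integral_functional[OF l]
  have zero: "y = 0" if "\<And>x. B x y = 0" for y
  proof -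
    have "B y = B 0"
      using that balanced_form_symmetric[OF B inj] functional_zero[OF lin(2)] by (auto simp: fun_eq_iff)
    then show ?thesis
      using inj by (simp add: inj_def)
  qed
  obtain z' where z': "t z' \<noteq> 0"
    using zero[of 1] balanced_form_symmetric[OF B inj, of _ 1] by (auto simp: t_def)
  define z where "z = scale (inverse (t z')) z'"
  have z: "t z = 1"
    using z' by (simp add: z_def functional_scale[OF ft])
  obtain w where w: "functional w" and B_w: "B = twisted_form t w"
    by (rule balanced_form_twisted[OF B l r z])
  have "inj (\<lambda>y. y \<leftharpoonup> w)"
  proof (rule injI)
    fix y y' assume eq: "y \<leftharpoonup> w = y' \<leftharpoonup> w"
    have "B x (y - y') = 0" for x
      using eq functional_diff[OF lin(1), of x y y'] by (simp add: B_w twisted_form_def)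
    then show "y = y'"
      using zero[of "y - y'"] by simp
  qed
  then obtain u where u: "dual_inverses scale comult counit u w"
    by (rule right_act_injective_imp_invertible[OF w])
  have "\<forall>x. S (S (x \<leftharpoonup> w)) = w \<rightharpoonup> x"
    using B balanced_twisted_form_iff[OF l r z' w] by (simp add: B_w)
  then show ?thesis
    using antipode_square_inner_iff[OF u] two_sided_integral_unimodular[OF l r z'] u by blast
qed

lemma unimodular_inner_imp_symmetric:
  assumes uni: "unimodular scale comult" and uw: "dual_inverses scale comult counit u w"
    and inner: "\<And>h. S (S h) = (w \<rightharpoonup> h) \<leftharpoonup> u"
  shows "\<exists>B. balanced_form B \<and> inj B"
proof -
  obtain t where t: "left_integral t" "right_integral t" "t \<noteq> (\<lambda>x. 0)"
    using uni by (auto simp: unimodular_def)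
  then obtain z where z: "t z \<noteq> 0"
    by auto
  note ft = left_integral_functional[OF t(1)]
  have u: "functional u" and w: "functional w" and u_w: "u \<star> w = counit" and w_u: "w \<star> u = counit"
    using uw by (auto simp: dual_inverses_def dual_space_def)
  have twist: "\<forall>x. S (S (x \<leftharpoonup> w)) = w \<rightharpoonup> x"
    using antipode_square_inner_iff[OF uw] inner by simp
  define \<psi> where "\<psi> h = (u \<rightharpoonup> h) \<leftharpoonup> w" for h
  have \<psi>: "endomorphism \<psi>" "S (S (\<psi> h)) = h" for h
    using endomorphism_comp[OF endomorphism_right_act[OF w] endomorphism_left_act[OF u]] twist
    by (simp_all add: \<psi>_def[abs_def] left_act_left_act[OF w u] w_u left_act_counit)
  have "inj (twisted_form t w)"
  proof (rule injI)
    fix x x' assume eq: "twisted_form t w x = twisted_form t w x'"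
    have "t ((x - x') * S y) = 0" for y
    proof -
      have "y = y \<leftharpoonup> u \<leftharpoonup> w"
        by (simp add: right_act_right_act[OF u w] u_w right_act_counit)
      then have "t (x * S y) = t (x' * S y)"
        using fun_cong[OF eq, of "y \<leftharpoonup> u"] by (simp add: twisted_form_def)
      then show ?thesis
        by (simp add: left_diff_distrib functional_diff[OF ft])
    qed
    then have "x - x' = 0"
      by (rule left_integral_nondegenerate'[OF t(1) z _ \<psi>])
    then show "x = x'"
      by simp
  qed
  then show ?thesis
    using balanced_twisted_form_iff[OF t(1,2) z w] twist by blast
qed

end

theorem theorem8p1:
  fixes scale :: "'k::field \<Rightarrow> 'h::ring_1 \<Rightarrow> 'h"
    and comult :: "'h \<Rightarrow> ('h \<times> 'h) list"
    and counit :: "'h \<Rightarrow> 'k"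
    and S :: "'h \<Rightarrow> 'h"
  assumes "hopf_algebra scale comult counit S"
  shows "symmetric_coalgebra scale comult \<longleftrightarrow>
    unimodular scale comult \<and>
    (\<exists>u u_inv. dual_inverses scale comult counit u u_inv \<and>
      (\<forall>h. S (S h) = right_act scale comult (left_act scale comult u_inv h) u \<and>
           S (S h) = (\<Sum>(h1, h')\<leftarrow>comult h. \<Sum>(h2, h3)\<leftarrow>comult h'. scale (u h1 * u_inv h3) h2)))"
proof -
  interpret hopf_algebra scale comult counit S
    by (rule assms)
  have sum: "right_act scale comult (left_act scale comult w h) u =
      (\<Sum>(h1, h')\<leftarrow>comult h. \<Sum>(h2, h3)\<leftarrow>comult h'. scale (u h1 * w h3) h2)"
    if "dual_inverses scale comult counit u w" for u w h
    using that by (intro left_act_right_act_sum) (auto simp: dual_inverses_def dual_space_def)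
  show ?thesis
  proof
    assume "symmetric_coalgebra scale comult"
    then obtain B where "balanced_form B" "inj B"
      by (auto simp: symmetric_coalgebra_def dual_bimodule_hom_iff)
    then obtain u w where uni: "unimodular scale comult" and uw: "dual_inverses scale comult counit u w"
      and inner: "\<And>h. S (S h) = right_act scale comult (left_act scale comult w h) u"
      using symmetric_imp_unimodular_inner by blast
    have "S (S h) = (\<Sum>(h1, h')\<leftarrow>comult h. \<Sum>(h2, h3)\<leftarrow>comult h'. scale (u h1 * w h3) h2)" for h
      using inner[of h] sum[OF uw, of h] by simp
    then show "unimodular scale comult \<and>
      (\<exists>u u_inv. dual_inverses scale comult counit u u_inv \<and>
      (\<forall>h. S (S h) = right_act scale comult (left_act scale comult u_inv h) u \<and>
           S (S h) = (\<Sum>(h1, h')\<leftarrow>comult h. \<Sum>(h2, h3)\<leftarrow>comult h'. scale (u h1 * u_inv h3) h2)))"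
      using uni uw inner by blast
  next
    assume "unimodular scale comult \<and>
      (\<exists>u u_inv. dual_inverses scale comult counit u u_inv \<and>
      (\<forall>h. S (S h) = right_act scale comult (left_act scale comult u_inv h) u \<and>
           S (S h) = (\<Sum>(h1, h')\<leftarrow>comult h. \<Sum>(h2, h3)\<leftarrow>comult h'. scale (u h1 * u_inv h3) h2)))"
    then show "symmetric_coalgebra scale comult"
      using unimodular_inner_imp_symmetric unfolding symmetric_coalgebra_def dual_bimodule_hom_iff
      by blast
  qed
qed

end
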